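(* For every $0<c<1$, $$d_{\mathrm{BM}}(X_c,\ell_2)=\frac1c\qquad\text{and}\qquad d_{\mathrm{BM}}(X_c^*,\ell_2)=\frac1c.$$
   Context: All Banach spaces are real; $E^*$ is the dual of $E$ with the dual norm. The Banach--Mazur distance is $d_{\mathrm{BM}}(E,F)=\inf\{\|U\|\,\|U^{-1}\|: U:E\to F\text{ is an isomorphism}\}$. Definition of $X_c$. A norm $N$ on $\mathbb R^2$ is absolute if $N(s,t)=N(|s|,|t|)$ and normalized if $N(1,0)=N(0,1)=1$. Given a sequence $(N_n)_{n\ge1}$ of absolute normalized norms on $\mathbb R^2$, define norms $M_n$ on $\mathbb R^{n+1}$ by $M_0(x_0)=|x_0|$ and $M_n(x_0,\dots,x_n)=N_n(M_{n-1}(x_0,\dots,x_{n-1}),|x_n|)$ for $n\ge1$. For a finitely supported real sequence $x=(x_j)_{j\ge0}\in c_{00}$ put $\|x\|=M_n(x_0,\dots,x_n)$ for any $n$ with $x_j=0$ for all $j>n$ (this is independent of $n$). $A(N_n)$ denotes the completion of $c_{00}$ in this norm, with canonical basis $(e_j)_{j\ge0}$. For $0<c<1$ and $n\ge1$ let $$N_{n,c}(s,t)=\left[(1-c^{2n})|t|^{2n}+(s^2+c^2t^2)^n\right]^{1/(2n)},$$ which is an absolute normalized norm on $\mathbb R^2$, and set $X_c:=A(N_{n,c})$. *)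

theory Defs
  imports "HOL-Analysis.Analysis"
begin

section \<open>Real normed spaces with explicit carrier\<close>

text \<open>
  The space \<open>X\<^sub>c\<close> depends on a real parameter, so it cannot be an instance of the type class
  \<^class>\<open>banach\<close>; normed spaces are therefore represented by records.
\<close>

record 'a nspace =
  pts :: "'a set"
  add :: "'a \<Rightarrow> 'a \<Rightarrow> 'a"
  zero :: 'a
  scl :: "real \<Rightarrow> 'a \<Rightarrow> 'a"
  nrm :: "'a \<Rightarrow> real"

definition diff :: "'a nspace \<Rightarrow> 'a \<Rightarrow> 'a \<Rightarrow> 'a"
  where "diff E x y = add E x (scl E (-1) y)"

locale real_nspace =
  fixes E :: "'a nspace"
  assumes add_closed: "\<lbrakk>x \<in> pts E; y \<in> pts E\<rbrakk> \<Longrightarrow> add E x y \<in> pts E"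
    and scl_closed: "x \<in> pts E \<Longrightarrow> scl E a x \<in> pts E"
    and zero_closed: "zero E \<in> pts E"
    and add_assoc: "\<lbrakk>x \<in> pts E; y \<in> pts E; z \<in> pts E\<rbrakk> \<Longrightarrow>
      add E (add E x y) z = add E x (add E y z)"
    and add_commute: "\<lbrakk>x \<in> pts E; y \<in> pts E\<rbrakk> \<Longrightarrow> add E x y = add E y x"
    and add_zero: "x \<in> pts E \<Longrightarrow> add E x (zero E) = x"
    and diff_self: "x \<in> pts E \<Longrightarrow> diff E x x = zero E"
    and scl_add_right: "\<lbrakk>x \<in> pts E; y \<in> pts E\<rbrakk> \<Longrightarrow>
      scl E a (add E x y) = add E (scl E a x) (scl E a y)"
    and scl_add_left: "x \<in> pts E \<Longrightarrow> scl E (a + b) x = add E (scl E a x) (scl E b x)"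
    and scl_scl: "x \<in> pts E \<Longrightarrow> scl E a (scl E b x) = scl E (a * b) x"
    and scl_one: "x \<in> pts E \<Longrightarrow> scl E 1 x = x"
    and nrm_eq_0: "x \<in> pts E \<Longrightarrow> nrm E x = 0 \<longleftrightarrow> x = zero E"
    and nrm_triangle: "\<lbrakk>x \<in> pts E; y \<in> pts E\<rbrakk> \<Longrightarrow> nrm E (add E x y) \<le> nrm E x + nrm E y"
    and nrm_scl: "x \<in> pts E \<Longrightarrow> nrm E (scl E a x) = \<bar>a\<bar> * nrm E x"

definition Cauchy_seqs :: "'a nspace \<Rightarrow> (nat \<Rightarrow> 'a) set"
  where "Cauchy_seqs E = {x. (\<forall>n. x n \<in> pts E) \<and>
    (\<forall>e>0. \<exists>k. \<forall>m\<ge>k. \<forall>n\<ge>k. nrm E (diff E (x m) (x n)) < e)}"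

locale banach_nspace = real_nspace +
  assumes complete: "x \<in> Cauchy_seqs E \<Longrightarrow>
    \<exists>l\<in>pts E. (\<lambda>n. nrm E (diff E (x n) l)) \<longlonglongrightarrow> 0"


section \<open>Operators, dual spaces, Banach--Mazur distance\<close>

definition bounded_op :: "'a nspace \<Rightarrow> 'b nspace \<Rightarrow> ('a \<Rightarrow> 'b) \<Rightarrow> bool"
  where "bounded_op E F T \<longleftrightarrow>
    (\<forall>x\<in>pts E. T x \<in> pts F) \<and>
    (\<forall>x\<in>pts E. \<forall>y\<in>pts E. T (add E x y) = add F (T x) (T y)) \<and>
    (\<forall>a. \<forall>x\<in>pts E. T (scl E a x) = scl F a (T x)) \<and>
    (\<exists>K. \<forall>x\<in>pts E. nrm F (T x) \<le> K * nrm E x)"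

definition op_norm :: "'a nspace \<Rightarrow> 'b nspace \<Rightarrow> ('a \<Rightarrow> 'b) \<Rightarrow> real"
  where "op_norm E F T = (SUP x\<in>{x \<in> pts E. nrm E x \<le> 1}. nrm F (T x))"

definition isomorphism :: "'a nspace \<Rightarrow> 'b nspace \<Rightarrow> ('a \<Rightarrow> 'b) \<Rightarrow> bool"
  where "isomorphism E F U \<longleftrightarrow> bounded_op E F U \<and> bij_betw U (pts E) (pts F) \<and>
    bounded_op F E (inv_into (pts E) U)"

text \<open>The value is \<open>\<infinity>\<close> if the spaces are not isomorphic.\<close>

definition bm_dist :: "'a nspace \<Rightarrow> 'b nspace \<Rightarrow> ereal"
  where "bm_dist E F =
    (INF U\<in>{U. isomorphism E F U}. ereal (op_norm E F U * op_norm F E (inv_into (pts E) U)))"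

definition real_line :: "real nspace"
  where "real_line = \<lparr>pts = UNIV, add = (+), zero = 0, scl = (*), nrm = abs\<rparr>"

text \<open>Functionals are \<^const>\<open>undefined\<close> off the carrier, so that equality of functionals is
  equality of functions.\<close>

definition dual :: "'a nspace \<Rightarrow> ('a \<Rightarrow> real) nspace"
  where "dual E = \<lparr>
    pts = {f \<in> extensional (pts E). bounded_op E real_line f},
    add = (\<lambda>f g. \<lambda>x\<in>pts E. f x + g x),
    zero = (\<lambda>x\<in>pts E. 0),
    scl = (\<lambda>a f. \<lambda>x\<in>pts E. a * f x),
    nrm = op_norm E real_line\<rparr>"

definition ell2 :: "(nat \<Rightarrow> real) nspace"
  where "ell2 = \<lparr>
    pts = {x. summable (\<lambda>j. (x j)\<^sup>2)},
    add = (\<lambda>x y j. x j + y j),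
    zero = (\<lambda>j. 0),
    scl = (\<lambda>a x j. a * x j),
    nrm = (\<lambda>x. sqrt (\<Sum>j. (x j)\<^sup>2))\<rparr>"


section \<open>Completion: Cauchy sequences modulo null sequences\<close>

definition Cauchy_rel :: "'a nspace \<Rightarrow> ((nat \<Rightarrow> 'a) \<times> (nat \<Rightarrow> 'a)) set"
  where "Cauchy_rel E = {(x, y). x \<in> Cauchy_seqs E \<and> y \<in> Cauchy_seqs E \<and>
    (\<lambda>n. nrm E (diff E (x n) (y n))) \<longlonglongrightarrow> 0}"

definition completion :: "'a nspace \<Rightarrow> (nat \<Rightarrow> 'a) set nspace"
  where "completion E = \<lparr>
    pts = Cauchy_seqs E // Cauchy_rel E,
    add = (\<lambda>P Q. \<Union>x\<in>P. \<Union>y\<in>Q. Cauchy_rel E `` {\<lambda>n. add E (x n) (y n)}),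
    zero = Cauchy_rel E `` {\<lambda>n. zero E},
    scl = (\<lambda>a P. \<Union>x\<in>P. Cauchy_rel E `` {\<lambda>n. scl E a (x n)}),
    nrm = (\<lambda>P. THE r. \<forall>x\<in>P. (\<lambda>n. nrm E (x n)) \<longlonglongrightarrow> r)\<rparr>"

lemma LIMSEQ_squeeze_0:
  fixes f g :: "nat \<Rightarrow> real"
  assumes "g \<longlonglongrightarrow> 0" "\<And>n. 0 \<le> f n" "\<And>n. f n \<le> g n"
  shows "f \<longlonglongrightarrow> 0"
  using assms by (intro tendsto_sandwich[of "\<lambda>_. 0" f sequentially g 0]) auto

context real_nspace
begin

lemma diff_closed: "\<lbrakk>x \<in> pts E; y \<in> pts E\<rbrakk> \<Longrightarrow> diff E x y \<in> pts E"
  by (simp add: diff_def add_closed scl_closed)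

lemma add_left_commute:
  "\<lbrakk>x \<in> pts E; y \<in> pts E; z \<in> pts E\<rbrakk> \<Longrightarrow> add E x (add E y z) = add E y (add E x z)"
  by (metis add_assoc add_commute)

lemmas add_ac = add_assoc add_commute add_left_commute

lemma nrm_zero: "nrm E (zero E) = 0"
  using nrm_eq_0 zero_closed by blast

lemma add_diff_cancel: "\<lbrakk>x \<in> pts E; y \<in> pts E\<rbrakk> \<Longrightarrow> add E y (diff E x y) = x"
  using diff_self[of y] add_zero[of x]
  by (simp add: diff_def add_left_commute scl_closed)

lemma diff_diff: "\<lbrakk>x \<in> pts E; y \<in> pts E; z \<in> pts E\<rbrakk> \<Longrightarrow>
    add E (diff E x y) (diff E y z) = diff E x z"
  by (metis add_assoc add_commute add_diff_cancel diff_closed diff_def scl_closed)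

lemma diff_add: "\<lbrakk>x \<in> pts E; y \<in> pts E; u \<in> pts E; v \<in> pts E\<rbrakk> \<Longrightarrow>
    diff E (add E x y) (add E u v) = add E (diff E x u) (diff E y v)"
  by (simp add: diff_def scl_add_right add_closed scl_closed add_assoc add_left_commute)

lemma diff_scl: "\<lbrakk>x \<in> pts E; y \<in> pts E\<rbrakk> \<Longrightarrow>
    diff E (scl E a x) (scl E a y) = scl E a (diff E x y)"
  by (simp add: diff_def scl_add_right scl_closed scl_scl)

lemma nrm_nonneg:
  assumes "x \<in> pts E" shows "0 \<le> nrm E x"
proof -
  have "0 \<le> nrm E x + nrm E (scl E (-1) x)"
    using nrm_triangle[of x "scl E (-1) x"] assms diff_self[of x]
    by (simp add: diff_def scl_closed nrm_zero)
  then show ?thesis using assms by (simp add: nrm_scl)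
qed

lemma nrm_diff_commute:
  assumes "x \<in> pts E" "y \<in> pts E" shows "nrm E (diff E x y) = nrm E (diff E y x)"
proof -
  have "diff E x y = scl E (-1) (diff E y x)"
    using assms
    by (simp add: diff_def scl_add_right scl_closed scl_scl scl_one add_commute)
  then show ?thesis using assms by (simp add: nrm_scl diff_closed)
qed

lemma nrm_diff_triangle:
  assumes "x \<in> pts E" "y \<in> pts E" "z \<in> pts E"
  shows "nrm E (diff E x z) \<le> nrm E (diff E x y) + nrm E (diff E y z)"
  using nrm_triangle[of "diff E x y" "diff E y z"] assms by (simp add: diff_diff diff_closed)

lemma abs_nrm_diff:
  assumes "x \<in> pts E" "y \<in> pts E" shows "\<bar>nrm E x - nrm E y\<bar> \<le> nrm E (diff E x y)"
  using nrm_triangle[of y "diff E x y"] nrm_triangle[of x "diff E y x"] assms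
  by (simp add: add_diff_cancel diff_closed nrm_diff_commute)

lemma diff_zero: "x \<in> pts E \<Longrightarrow> diff E x (zero E) = x"
  by (metis add_commute add_diff_cancel add_zero diff_closed zero_closed)

abbreviation "C \<equiv> Cauchy_seqs E"
abbreviation "R \<equiv> Cauchy_rel E"
abbreviation "cls x \<equiv> R `` {x}"
abbreviation "E' \<equiv> completion E"

lemma Cauchy_pts: "x \<in> C \<Longrightarrow> x n \<in> pts E"
  by (simp add: Cauchy_seqs_def)

lemma Cauchy_D: "x \<in> C \<Longrightarrow> e > 0 \<Longrightarrow> \<exists>k. \<forall>m\<ge>k. \<forall>n\<ge>k. nrm E (diff E (x m) (x n)) < e"
  by (simp add: Cauchy_seqs_def)

lemma Cauchy_E:
  assumes "x \<in> C" "e > 0"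
  obtains k where "\<And>m n. m \<ge> k \<Longrightarrow> n \<ge> k \<Longrightarrow> nrm E (diff E (x m) (x n)) < e"
  using Cauchy_D[OF assms] by blast

lemma Cauchy_const: "x \<in> pts E \<Longrightarrow> (\<lambda>n. x) \<in> C"
  by (simp add: Cauchy_seqs_def diff_self nrm_zero)

lemma Cauchy_add:
  assumes "x \<in> C" "y \<in> C" shows "(\<lambda>n. add E (x n) (y n)) \<in> C"
proof -
  have "\<exists>k. \<forall>m\<ge>k. \<forall>n\<ge>k. nrm E (diff E (add E (x m) (y m)) (add E (x n) (y n))) < e"
    if e: "e > 0" for e
  proof -
    have e2: "e/2 > 0" using e by simp
    obtain k1 where k1: "\<And>m n. m \<ge> k1 \<Longrightarrow> n \<ge> k1 \<Longrightarrow> nrm E (diff E (x m) (x n)) < e/2"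
      using Cauchy_E[OF assms(1) e2] by blast
    obtain k2 where k2: "\<And>m n. m \<ge> k2 \<Longrightarrow> n \<ge> k2 \<Longrightarrow> nrm E (diff E (y m) (y n)) < e/2"
      using Cauchy_E[OF assms(2) e2] by blast
    have "nrm E (diff E (add E (x m) (y m)) (add E (x n) (y n))) < e"
      if "m \<ge> max k1 k2" "n \<ge> max k1 k2" for m n
      using k1[of m n] k2[of m n] that
        nrm_triangle[of "diff E (x m) (x n)" "diff E (y m) (y n)"] assms
      by (simp add: diff_add diff_closed Cauchy_pts)
    then show ?thesis by blast
  qed
  then show ?thesis using assms by (simp add: Cauchy_seqs_def add_closed)
qed

lemma Cauchy_scl:
  assumes "x \<in> C" shows "(\<lambda>n. scl E a (x n)) \<in> C"
proof -
  have "\<exists>k. \<forall>m\<ge>k. \<forall>n\<ge>k. nrm E (diff E (scl E a (x m)) (scl E a (x n))) < e"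
    if "e > 0" for e
  proof -
    have p: "e / (\<bar>a\<bar> + 1) > 0" using that by simp
    obtain k where k: "\<And>m n. m \<ge> k \<Longrightarrow> n \<ge> k \<Longrightarrow> nrm E (diff E (x m) (x n)) < e / (\<bar>a\<bar> + 1)"
      using Cauchy_E[OF assms p] by blast
    have "nrm E (diff E (scl E a (x m)) (scl E a (x n))) < e"
      if "m \<ge> k" "n \<ge> k" for m n
    proof -
      have "nrm E (diff E (scl E a (x m)) (scl E a (x n))) = \<bar>a\<bar> * nrm E (diff E (x m) (x n))"
        using assms by (simp add: diff_scl nrm_scl diff_closed Cauchy_pts)
      also have "\<dots> \<le> (\<bar>a\<bar> + 1) * nrm E (diff E (x m) (x n))"
        using assms by (simp add: mult_right_mono nrm_nonneg diff_closed Cauchy_pts)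
      also have "\<dots> < e" using k[OF that] by (simp add: field_simps)
      finally show ?thesis .
    qed
    then show ?thesis by blast
  qed
  then show ?thesis using assms by (simp add: Cauchy_seqs_def scl_closed)
qed

lemma in_R: "(x, y) \<in> R \<longleftrightarrow> x \<in> C \<and> y \<in> C \<and> (\<lambda>n. nrm E (diff E (x n) (y n))) \<longlonglongrightarrow> 0"
  by (simp add: Cauchy_rel_def)

lemma equiv_R: "equiv C R"
proof (rule equivI)
  show "R \<subseteq> C \<times> C" by (auto simp: in_R)
  show "refl_on C R" by (rule refl_onI) (simp add: in_R diff_self nrm_zero Cauchy_pts)
  show "sym R" by (rule symI) (auto simp: in_R nrm_diff_commute Cauchy_pts)
  show "trans R"
  proof (rule transI)
    fix x y z assume a: "(x, y) \<in> R" "(y, z) \<in> R"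
    have "(\<lambda>n. nrm E (diff E (x n) (y n)) + nrm E (diff E (y n) (z n))) \<longlonglongrightarrow> 0"
      using a by (intro tendsto_add_zero) (auto simp: in_R)
    then have "(\<lambda>n. nrm E (diff E (x n) (z n))) \<longlonglongrightarrow> 0"
      by (rule LIMSEQ_squeeze_0)
         (use a in \<open>auto simp: in_R Cauchy_pts diff_closed nrm_nonneg nrm_diff_triangle\<close>)
    then show "(x, z) \<in> R" using a by (auto simp: in_R)
  qed
qed

lemma cls_eq: "\<lbrakk>x \<in> C; y \<in> C\<rbrakk> \<Longrightarrow>
    cls x = cls y \<longleftrightarrow> (\<lambda>n. nrm E (diff E (x n) (y n))) \<longlonglongrightarrow> 0"
  using eq_equiv_class_iff[OF equiv_R] by (simp add: in_R)

lemma pts_completion: "pts E' = cls ` C"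
  by (auto simp: completion_def quotient_def)

lemma zero_completion: "zero E' = cls (\<lambda>n. zero E)"
  by (simp add: completion_def)

lemma add_completion:
  assumes "x \<in> C" "y \<in> C"
  shows "add E' (cls x) (cls y) = cls (\<lambda>n. add E (x n) (y n))"
proof -
  have "congruent2 R R (\<lambda>x y. cls (\<lambda>n. add E (x n) (y n)))"
  proof (rule congruent2I')
    fix x x' y y' assume a: "(x, x') \<in> R" "(y, y') \<in> R"
    have "(\<lambda>n. nrm E (diff E (x n) (x' n)) + nrm E (diff E (y n) (y' n))) \<longlonglongrightarrow> 0"
      using a by (intro tendsto_add_zero) (auto simp: in_R)
    then have "(\<lambda>n. nrm E (diff E (add E (x n) (y n)) (add E (x' n) (y' n)))) \<longlonglongrightarrow> 0"
      by (rule LIMSEQ_squeeze_0)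
         (use a in \<open>auto simp: in_R diff_add Cauchy_pts diff_closed add_closed
            nrm_nonneg nrm_triangle\<close>)
    then show "cls (\<lambda>n. add E (x n) (y n)) = cls (\<lambda>n. add E (x' n) (y' n))"
      using a by (simp add: cls_eq in_R Cauchy_add)
  qed
  then show ?thesis
    using UN_equiv_class2[OF equiv_R equiv_R _ assms] by (simp add: completion_def)
qed

lemma scl_completion:
  assumes "x \<in> C"
  shows "scl E' a (cls x) = cls (\<lambda>n. scl E a (x n))"
proof -
  have "congruent R (\<lambda>x. cls (\<lambda>n. scl E a (x n)))"
  proof (rule congruentI)
    fix x x' assume a: "(x, x') \<in> R"
    have "(\<lambda>n. \<bar>a\<bar> * nrm E (diff E (x n) (x' n))) \<longlonglongrightarrow> 0"
      using a by (intro tendsto_mult_right_zero) (auto simp: in_R)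
    then have "(\<lambda>n. nrm E (diff E (scl E a (x n)) (scl E a (x' n)))) \<longlonglongrightarrow> 0"
      using a by (simp add: in_R diff_scl nrm_scl Cauchy_pts diff_closed)
    then show "cls (\<lambda>n. scl E a (x n)) = cls (\<lambda>n. scl E a (x' n))"
      using a by (simp add: cls_eq in_R Cauchy_scl)
  qed
  then show ?thesis
    using UN_equiv_class[OF equiv_R _ assms] by (simp add: completion_def)
qed

lemma diff_completion:
  assumes "x \<in> C" "y \<in> C"
  shows "diff E' (cls x) (cls y) = cls (\<lambda>n. diff E (x n) (y n))"
  using assms by (simp add: diff_def add_completion scl_completion Cauchy_scl)

lemma Cauchy_diff:
  assumes "x \<in> C" "y \<in> C" shows "(\<lambda>n. diff E (x n) (y n)) \<in> C"
  using assms by (simp add: diff_def Cauchy_add Cauchy_scl)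

lemma nrm_completion:
  assumes "x \<in> C"
  shows "(\<lambda>n. nrm E (x n)) \<longlonglongrightarrow> nrm E' (cls x)"
proof -
  have "Cauchy (\<lambda>n. nrm E (x n))"
  proof (rule metric_CauchyI)
    fix e :: real assume "e > 0"
    then obtain k where k: "\<And>m n. m \<ge> k \<Longrightarrow> n \<ge> k \<Longrightarrow> nrm E (diff E (x m) (x n)) < e"
      using Cauchy_E[OF assms] by blast
    then show "\<exists>M. \<forall>m\<ge>M. \<forall>n\<ge>M. dist (nrm E (x m)) (nrm E (x n)) < e"
      using abs_nrm_diff[OF Cauchy_pts[OF assms] Cauchy_pts[OF assms]]
      by (metis dist_real_def le_less_trans)
  qed
  then obtain r where r: "(\<lambda>n. nrm E (x n)) \<longlonglongrightarrow> r"
    using Cauchy_convergent convergent_def by blast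
  have all: "(\<lambda>n. nrm E (y n)) \<longlonglongrightarrow> r" if "y \<in> cls x" for y
  proof -
    have y: "(x, y) \<in> R" using that by simp
    have "(\<lambda>n. nrm E (x n) - nrm E (y n)) \<longlonglongrightarrow> 0"
      by (rule Lim_null_comparison[where g = "\<lambda>n. nrm E (diff E (x n) (y n))"])
         (use y in \<open>auto simp: in_R abs_nrm_diff Cauchy_pts\<close>)
    from tendsto_diff[OF r this] show ?thesis by simp
  qed
  have self: "x \<in> cls x" using assms equiv_class_self[OF equiv_R] by blast
  have "nrm E' (cls x) = (THE r. \<forall>y\<in>cls x. (\<lambda>n. nrm E (y n)) \<longlonglongrightarrow> r)"
    by (simp add: completion_def)
  also have "\<dots> = r"
  proof (rule the_equality)
    show "\<forall>y\<in>cls x. (\<lambda>n. nrm E (y n)) \<longlonglongrightarrow> r" using all by blast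
    fix r' assume "\<forall>y\<in>cls x. (\<lambda>n. nrm E (y n)) \<longlonglongrightarrow> r'"
    then show "r' = r" using self LIMSEQ_unique[OF _ r] by blast
  qed
  finally show ?thesis using r by simp
qed

lemma nrm_completionI: "x \<in> C \<Longrightarrow> (\<lambda>n. nrm E (x n)) \<longlonglongrightarrow> r \<Longrightarrow> nrm E' (cls x) = r"
  using nrm_completion LIMSEQ_unique by blast

lemma real_nspace_completion: "real_nspace E'"
proof (unfold_locales, unfold pts_completion; (elim imageE, hypsubst)?)
  fix x y assume "x \<in> C" "y \<in> C"
  then show "add E' (cls x) (cls y) \<in> cls ` C" by (simp add: add_completion Cauchy_add)
next
  fix x a assume "x \<in> C"
  then show "scl E' a (cls x) \<in> cls ` C" by (simp add: scl_completion Cauchy_scl)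
next
  show "zero E' \<in> cls ` C" by (simp add: zero_completion Cauchy_const zero_closed)
next
  fix x y z assume "x \<in> C" "y \<in> C" "z \<in> C"
  then show "add E' (add E' (cls x) (cls y)) (cls z) = add E' (cls x) (add E' (cls y) (cls z))"
    by (simp add: add_completion Cauchy_add add_assoc Cauchy_pts)
next
  fix x y assume "x \<in> C" "y \<in> C"
  then show "add E' (cls x) (cls y) = add E' (cls y) (cls x)"
    by (simp add: add_completion add_commute Cauchy_pts)
next
  fix x assume "x \<in> C"
  then show "add E' (cls x) (zero E') = cls x"
    by (simp add: add_completion zero_completion Cauchy_const zero_closed add_zero Cauchy_pts)
next
  fix x assume "x \<in> C"
  then show "diff E' (cls x) (cls x) = zero E'"
    by (simp add: diff_completion zero_completion diff_self Cauchy_pts)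
next
  fix x y a assume "x \<in> C" "y \<in> C"
  then show "scl E' a (add E' (cls x) (cls y)) = add E' (scl E' a (cls x)) (scl E' a (cls y))"
    by (simp add: add_completion scl_completion Cauchy_add Cauchy_scl scl_add_right Cauchy_pts)
next
  fix x a b assume "x \<in> C"
  then show "scl E' (a + b) (cls x) = add E' (scl E' a (cls x)) (scl E' b (cls x))"
    by (simp add: add_completion scl_completion Cauchy_scl scl_add_left Cauchy_pts)
next
  fix x a b assume "x \<in> C"
  then show "scl E' a (scl E' b (cls x)) = scl E' (a * b) (cls x)"
    by (simp add: scl_completion Cauchy_scl scl_scl Cauchy_pts)
next
  fix x assume "x \<in> C"
  then show "scl E' 1 (cls x) = cls x"
    by (simp add: scl_completion scl_one Cauchy_pts)
next
  fix x assume x: "x \<in> C"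
  have "nrm E' (cls x) = 0 \<longleftrightarrow> (\<lambda>n. nrm E (x n)) \<longlonglongrightarrow> 0"
    using nrm_completion[OF x] nrm_completionI[OF x] by metis
  then show "nrm E' (cls x) = 0 \<longleftrightarrow> cls x = zero E'"
    using x by (simp add: zero_completion cls_eq Cauchy_const zero_closed diff_zero Cauchy_pts)
next
  fix x y assume xy: "x \<in> C" "y \<in> C"
  show "nrm E' (add E' (cls x) (cls y)) \<le> nrm E' (cls x) + nrm E' (cls y)"
    using xy
    by (intro LIMSEQ_le[OF nrm_completion[OF Cauchy_add[OF xy], folded add_completion[OF xy]]
          tendsto_add[OF nrm_completion[OF xy(1)] nrm_completion[OF xy(2)]]])
       (auto simp: nrm_triangle Cauchy_pts)
next
  fix x a assume x: "x \<in> C"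
  have "(\<lambda>n. nrm E (scl E a (x n))) \<longlonglongrightarrow> \<bar>a\<bar> * nrm E' (cls x)"
    using tendsto_mult_left[OF nrm_completion[OF x]] x by (simp add: nrm_scl Cauchy_pts)
  then show "nrm E' (scl E' a (cls x)) = \<bar>a\<bar> * nrm E' (cls x)"
    using x by (simp add: scl_completion nrm_completionI Cauchy_scl)
qed

text \<open>The canonical map of \<open>E\<close> into its completion is an isometry with dense range.\<close>

lemma completion_isometry:
  "x \<in> pts E \<Longrightarrow> nrm E' (cls (\<lambda>n. x)) = nrm E x"
  by (rule nrm_completionI) (simp_all add: Cauchy_const)

lemma completion_approx:
  assumes "x \<in> C"
  shows "(\<lambda>k. nrm E' (diff E' (cls (\<lambda>n. x k)) (cls x))) \<longlonglongrightarrow> 0"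
proof (rule LIMSEQ_I)
  fix e :: real assume e: "e > 0"
  have e2: "e/2 > 0" using e by simp
  obtain k0 where k0: "\<And>m n. m \<ge> k0 \<Longrightarrow> n \<ge> k0 \<Longrightarrow> nrm E (diff E (x m) (x n)) < e/2"
    using Cauchy_E[OF assms e2] by blast
  interpret E': real_nspace E' by (rule real_nspace_completion)
  have "norm (nrm E' (diff E' (cls (\<lambda>n. x k)) (cls x)) - 0) < e" if "k \<ge> k0" for k
  proof -
    have c: "(\<lambda>n. x k) \<in> C" using assms by (simp add: Cauchy_const Cauchy_pts)
    have "(\<lambda>n. nrm E (diff E (x k) (x n))) \<longlonglongrightarrow> nrm E' (diff E' (cls (\<lambda>n. x k)) (cls x))"
      using nrm_completion[OF Cauchy_diff[OF c assms]] by (simp add: diff_completion[OF c assms])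
    then have "nrm E' (diff E' (cls (\<lambda>n. x k)) (cls x)) \<le> e/2"
      by (rule LIMSEQ_le_const2) (use k0 that less_imp_le in blast)
    moreover have "0 \<le> nrm E' (diff E' (cls (\<lambda>n. x k)) (cls x))"
      using c assms by (intro E'.nrm_nonneg E'.diff_closed) (auto simp: pts_completion)
    ultimately show ?thesis using e by simp
  qed
  then show "\<exists>no. \<forall>k\<ge>no. norm (nrm E' (diff E' (cls (\<lambda>n. x k)) (cls x)) - 0) < e" by blast
qed

lemma banach_nspace_completion: "banach_nspace E'"
proof -
  interpret E': real_nspace E' by (rule real_nspace_completion)
  show ?thesis
  proof
    fix X assume X: "X \<in> Cauchy_seqs E'"
    then have "\<forall>n. \<exists>x. x \<in> C \<and> X n = cls x"
      by (auto simp: Cauchy_seqs_def pts_completion image_iff)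
    then obtain x where x: "\<And>n. x n \<in> C" "\<And>n. X n = cls (x n)" by metis
    have Xp: "X n \<in> pts E'" for n using X by (simp add: Cauchy_seqs_def)
    let ?c = "\<lambda>a. cls (\<lambda>n::nat. a)"
    have "\<exists>a. a \<in> pts E \<and> nrm E' (diff E' (?c a) (X n)) < inverse (Suc n)" for n
    proof -
      have "\<forall>\<^sub>F k in sequentially. nrm E' (diff E' (?c (x n k)) (X n)) < inverse (Suc n)"
        using order_tendstoD(2)[OF completion_approx[OF x(1)[of n]], of "inverse (Suc n)"] x(2) by simp
      then obtain k where "nrm E' (diff E' (?c (x n k)) (X n)) < inverse (Suc n)"
        by (meson eventually_happens' sequentially_bot)
      then show ?thesis using Cauchy_pts[OF x(1)] by blast
    qed
    then obtain a where a: "\<And>n. a n \<in> pts E"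
      "\<And>n. nrm E' (diff E' (?c (a n)) (X n)) < inverse (Suc n)" by metis
    have cC: "(\<lambda>n. u) \<in> C" if "u \<in> pts E" for u using that by (rule Cauchy_const)
    have cp: "?c (a n) \<in> pts E'" for n using a(1) by (auto simp: pts_completion cC)
    have cd: "nrm E (diff E (a m) (a n)) = nrm E' (diff E' (?c (a m)) (?c (a n)))" for m n
      using a(1) by (simp add: diff_completion cC completion_isometry diff_closed)
    have lim0: "(\<lambda>n. nrm E' (diff E' (?c (a n)) (X n))) \<longlonglongrightarrow> 0"
      by (rule LIMSEQ_squeeze_0[OF LIMSEQ_inverse_real_of_nat])
         (use a(2) in \<open>auto simp: E'.nrm_nonneg E'.diff_closed cp Xp intro!: less_imp_le\<close>)
    have aC: "a \<in> C"
    proof -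
      have "\<exists>k. \<forall>m\<ge>k. \<forall>n\<ge>k. nrm E (diff E (a m) (a n)) < e" if e: "e > 0" for e
      proof -
        have e3: "e/3 > 0" using e by simp
        obtain k1 where k1: "\<And>m n. m \<ge> k1 \<Longrightarrow> n \<ge> k1 \<Longrightarrow> nrm E' (diff E' (X m) (X n)) < e/3"
          using E'.Cauchy_E[OF X e3] by blast
        obtain k2 where k2: "\<And>n. n \<ge> k2 \<Longrightarrow> nrm E' (diff E' (?c (a n)) (X n)) < e/3"
          using order_tendstoD(2)[OF lim0, of "e/3"] e by (auto simp: eventually_sequentially)
        have "nrm E (diff E (a m) (a n)) < e" if "m \<ge> max k1 k2" "n \<ge> max k1 k2" for m n
        proof -
          have "nrm E' (diff E' (?c (a m)) (?c (a n)))
              \<le> nrm E' (diff E' (?c (a m)) (X m)) + nrm E' (diff E' (X m) (?c (a n)))"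
            by (rule E'.nrm_diff_triangle[OF cp Xp cp])
          also have "nrm E' (diff E' (X m) (?c (a n)))
              \<le> nrm E' (diff E' (X m) (X n)) + nrm E' (diff E' (X n) (?c (a n)))"
            by (rule E'.nrm_diff_triangle[OF Xp Xp cp])
          also have "nrm E' (diff E' (X n) (?c (a n))) = nrm E' (diff E' (?c (a n)) (X n))"
            by (rule E'.nrm_diff_commute[OF Xp cp])
          finally show ?thesis using k1[of m n] k2[of m] k2[of n] that by (simp add: cd)
        qed
        then show ?thesis by blast
      qed
      then show ?thesis using a(1) by (simp add: Cauchy_seqs_def)
    qed
    have l: "cls a \<in> pts E'" using aC by (auto simp: pts_completion)
    have "(\<lambda>n. nrm E' (diff E' (?c (a n)) (X n)) + nrm E' (diff E' (?c (a n)) (cls a))) \<longlonglongrightarrow> 0"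
      by (intro tendsto_add_zero lim0 completion_approx aC)
    then have "(\<lambda>n. nrm E' (diff E' (X n) (cls a))) \<longlonglongrightarrow> 0"
    proof (rule LIMSEQ_squeeze_0)
      fix n
      show "0 \<le> nrm E' (diff E' (X n) (cls a))"
        by (simp add: E'.nrm_nonneg E'.diff_closed Xp l)
      show "nrm E' (diff E' (X n) (cls a))
          \<le> nrm E' (diff E' (?c (a n)) (X n)) + nrm E' (diff E' (?c (a n)) (cls a))"
        using E'.nrm_diff_triangle[OF Xp cp l] E'.nrm_diff_commute[OF Xp cp] by metis
    qed
    then show "\<exists>l\<in>pts E'. (\<lambda>n. nrm E' (diff E' (X n) l)) \<longlonglongrightarrow> 0" using l by blast
  qed
qed

end


section \<open>The spaces \<open>A(N\<^sub>n)\<close> and \<open>X\<^sub>c\<close>\<close>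

definition absolute_normalized_norm :: "(real \<Rightarrow> real \<Rightarrow> real) \<Rightarrow> bool"
  where "absolute_normalized_norm N \<longleftrightarrow>
    (\<forall>s t. N s t = 0 \<longleftrightarrow> s = 0 \<and> t = 0) \<and>
    (\<forall>a s t. N (a * s) (a * t) = \<bar>a\<bar> * N s t) \<and>
    (\<forall>s t s' t'. N (s + s') (t + t') \<le> N s t + N s' t') \<and>
    (\<forall>s t. N s t = N \<bar>s\<bar> \<bar>t\<bar>) \<and> N 1 0 = 1 \<and> N 0 1 = 1"

text \<open>\<open>N n\<close> is used for \<open>n \<ge> 1\<close> only; the value \<open>N 0\<close> is irrelevant.\<close>

fun Mn :: "(nat \<Rightarrow> real \<Rightarrow> real \<Rightarrow> real) \<Rightarrow> nat \<Rightarrow> (nat \<Rightarrow> real) \<Rightarrow> real" where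
  "Mn N 0 x = \<bar>x 0\<bar>"
| "Mn N (Suc n) x = N (Suc n) (Mn N n x) \<bar>x (Suc n)\<bar>"

definition c00 :: "(nat \<Rightarrow> real \<Rightarrow> real \<Rightarrow> real) \<Rightarrow> (nat \<Rightarrow> real) nspace"
  where "c00 N = \<lparr>
    pts = {x. finite {j. x j \<noteq> 0}},
    add = (\<lambda>x y j. x j + y j),
    zero = (\<lambda>j. 0),
    scl = (\<lambda>a x j. a * x j),
    nrm = (\<lambda>x. Mn N (LEAST n. \<forall>j>n. x j = 0) x)\<rparr>"

definition Aspace :: "(nat \<Rightarrow> real \<Rightarrow> real \<Rightarrow> real) \<Rightarrow> (nat \<Rightarrow> nat \<Rightarrow> real) set nspace"
  where "Aspace N = completion (c00 N)"

lemma absolute_norm_mono: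
  assumes N: "absolute_normalized_norm N" and s: "0 \<le> s" "s \<le> s'"
  shows "N s t \<le> N s' t"
proof (cases "s' = 0")
  case True
  then show ?thesis using s by simp
next
  case False
  then have s': "s' > 0" using s by simp
  define a where "a = (1 + s / s') / 2"
  have a: "0 \<le> a" "a \<le> 1" using s s' by (auto simp: a_def)
  have e: "s = a * s' + (1 - a) * (- s')" "t = a * t + (1 - a) * t"
    using s' by (auto simp: a_def field_simps)
  have sym: "N (- s') t = N s' t"
    using N unfolding absolute_normalized_norm_def by (metis abs_minus_cancel)
  have "N s t \<le> N (a * s') (a * t) + N ((1 - a) * (- s')) ((1 - a) * t)"
    using N e unfolding absolute_normalized_norm_def by metis
  also have "\<dots> = \<bar>a\<bar> * N s' t + \<bar>1 - a\<bar> * N (- s') t"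
    using N unfolding absolute_normalized_norm_def by metis
  also have "\<dots> = N s' t" using a sym by (simp add: algebra_simps)
  finally show ?thesis .
qed

lemma absolute_norm_mono2:
  assumes N: "absolute_normalized_norm N" and t: "0 \<le> t" "t \<le> t'"
  shows "N s t \<le> N s t'"
proof -
  have "absolute_normalized_norm (\<lambda>s t. N t s)"
    using N unfolding absolute_normalized_norm_def by (metis add.commute)
  from absolute_norm_mono[OF this t] show ?thesis .
qed

lemma absolute_norm_nonneg: "absolute_normalized_norm N \<Longrightarrow> 0 \<le> N s t"
proof -
  assume N: "absolute_normalized_norm N"
  have "N (s + - s) (t + - t) \<le> N s t + N (- s) (- t)" "N (- s) (- t) = N s t"
    "N 0 0 = 0"
    using N unfolding absolute_normalized_norm_def by (metis, metis abs_minus_cancel, metis)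
  then show ?thesis by simp
qed

context
  fixes N :: "nat \<Rightarrow> real \<Rightarrow> real \<Rightarrow> real"
  assumes N: "\<And>n. n \<ge> 1 \<Longrightarrow> absolute_normalized_norm (N n)"
begin

lemma N_Suc: "absolute_normalized_norm (N (Suc n))"
  using N by simp

lemma N_eq_0: "N (Suc n) s t = 0 \<longleftrightarrow> s = 0 \<and> t = 0"
  using N_Suc[of n] by (simp add: absolute_normalized_norm_def)

lemma N_scale: "N (Suc n) (\<bar>a\<bar> * s) (\<bar>a\<bar> * t) = \<bar>a\<bar> * N (Suc n) s t"
  using N_Suc[of n] by (simp add: absolute_normalized_norm_def)

lemma N_triangle: "N (Suc n) (s + s') (t + t') \<le> N (Suc n) s t + N (Suc n) s' t'"
  using N_Suc[of n] by (simp add: absolute_normalized_norm_def)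

lemma N_s0: "s \<ge> 0 \<Longrightarrow> N (Suc n) s 0 = s"
  using N_scale[of n s 1 0] N_Suc[of n] by (simp add: absolute_normalized_norm_def)

lemma Mn_nonneg: "0 \<le> Mn N n x"
  by (cases n) (auto simp: absolute_norm_nonneg N_Suc)

lemma Mn_eq_0: "Mn N n x = 0 \<longleftrightarrow> (\<forall>j\<le>n. x j = 0)"
  by (induction n) (auto simp: N_eq_0 le_Suc_eq)

lemma Mn_scale: "Mn N n (\<lambda>j. a * x j) = \<bar>a\<bar> * Mn N n x"
  by (induction n) (auto simp: abs_mult N_scale)

lemma Mn_triangle: "Mn N n (\<lambda>j. x j + y j) \<le> Mn N n x + Mn N n y"
proof (induction n)
  case 0
  then show ?case by simp
next
  case (Suc n)
  have "N (Suc n) (Mn N n (\<lambda>j. x j + y j)) \<bar>x (Suc n) + y (Suc n)\<bar>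
     \<le> N (Suc n) (Mn N n x + Mn N n y) \<bar>x (Suc n) + y (Suc n)\<bar>"
    by (rule absolute_norm_mono[OF N_Suc Mn_nonneg Suc])
  also have "\<dots> \<le> N (Suc n) (Mn N n x + Mn N n y) (\<bar>x (Suc n)\<bar> + \<bar>y (Suc n)\<bar>)"
    by (rule absolute_norm_mono2[OF N_Suc]) auto
  also have "\<dots> \<le> Mn N (Suc n) x + Mn N (Suc n) y"
    by (simp add: N_triangle)
  finally show ?case by simp
qed

lemma Mn_stable:
  assumes "\<forall>j>n. x j = 0" "n \<le> m" shows "Mn N m x = Mn N n x"
  using assms(2)
proof (induction m rule: dec_induct)
  case (step k)
  then show ?case using assms(1) by (simp add: N_s0 Mn_nonneg)
qed simp

text \<open>The norm on \<open>c\<^sub>0\<^sub>0\<close> does not depend on the choice of \<open>n\<close>.\<close>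

lemma nrm_c00:
  assumes "\<forall>j>n. x j = 0" shows "nrm (c00 N) x = Mn N n x"
proof -
  have "\<forall>j>(LEAST n. \<forall>j>n. x j = 0). x j = 0" using assms by (rule LeastI)
  moreover have "(LEAST n. \<forall>j>n. x j = 0) \<le> n" using assms by (rule Least_le)
  ultimately have "Mn N n x = Mn N (LEAST n. \<forall>j>n. x j = 0) x" by (rule Mn_stable)
  then show ?thesis by (simp add: c00_def)
qed

lemma c00_bound:
  assumes "x \<in> pts (c00 N)" shows "\<exists>n. \<forall>j>n. x j = 0"
proof -
  obtain n where "\<forall>j\<in>{j. x j \<noteq> 0}. j \<le> n"
    using assms finite_nat_set_iff_bounded_le by (auto simp: c00_def)
  then have "\<forall>j>n. x j = 0" by force
  then show ?thesis by blast
qed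

lemma c00_ops:
  "add (c00 N) = (\<lambda>x y j. x j + y j)" "zero (c00 N) = (\<lambda>j. 0)"
  "scl (c00 N) = (\<lambda>a x j. a * x j)" "pts (c00 N) = {x. finite {j. x j \<noteq> 0}}"
  by (simp_all add: c00_def)

lemma real_nspace_c00: "real_nspace (c00 N)"
proof
  fix x y assume xy: "x \<in> pts (c00 N)" "y \<in> pts (c00 N)"
  have "{j. x j + y j \<noteq> 0} \<subseteq> {j. x j \<noteq> 0} \<union> {j. y j \<noteq> 0}" by auto
  then show "add (c00 N) x y \<in> pts (c00 N)"
    using xy finite_subset by (auto simp: c00_ops)
  obtain n m where nm: "\<forall>j>n. x j = 0" "\<forall>j>m. y j = 0"
    using c00_bound xy by meson
  define k where "k = max n m"
  have k: "\<forall>j>k. x j = 0" "\<forall>j>k. y j = 0" "\<forall>j>k. x j + y j = 0"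
    using nm by (auto simp: k_def)
  show "nrm (c00 N) (add (c00 N) x y) \<le> nrm (c00 N) x + nrm (c00 N) y"
    using Mn_triangle by (simp add: c00_ops nrm_c00[OF k(1)] nrm_c00[OF k(2)] nrm_c00[OF k(3)])
next
  fix x a assume x: "x \<in> pts (c00 N)"
  have "{j. a * x j \<noteq> 0} \<subseteq> {j. x j \<noteq> 0}" by auto
  then show "scl (c00 N) a x \<in> pts (c00 N)"
    using x finite_subset by (auto simp: c00_ops)
  obtain n where n: "\<forall>j>n. x j = 0" using c00_bound[OF x] by blast
  then have n': "\<forall>j>n. a * x j = 0" by simp
  show "nrm (c00 N) (scl (c00 N) a x) = \<bar>a\<bar> * nrm (c00 N) x"
    by (simp add: c00_ops nrm_c00[OF n] nrm_c00[OF n'] Mn_scale)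
  show "nrm (c00 N) x = 0 \<longleftrightarrow> x = zero (c00 N)"
    using n by (simp add: c00_ops nrm_c00[OF n] Mn_eq_0 fun_eq_iff) (meson not_le)
qed (auto simp: c00_ops diff_def algebra_simps)

lemma banach_nspace_Aspace: "banach_nspace (Aspace N)"
  unfolding Aspace_def by (rule real_nspace.banach_nspace_completion[OF real_nspace_c00])

end

definition Nc :: "real \<Rightarrow> nat \<Rightarrow> real \<Rightarrow> real \<Rightarrow> real"
  where "Nc c n s t =
    root (2 * n) ((1 - c ^ (2 * n)) * \<bar>t\<bar> ^ (2 * n) + (s\<^sup>2 + c\<^sup>2 * t\<^sup>2) ^ n)"

lemma Minkowski_2:
  fixes x y u v :: real
  assumes p: "0 < p" and nn: "0 \<le> x" "0 \<le> y" "0 \<le> u" "0 \<le> v"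
  shows "root p ((x + y) ^ p + (u + v) ^ p) \<le> root p (x ^ p + u ^ p) + root p (y ^ p + v ^ p)"
proof -
  define A where "A = root p (x ^ p + u ^ p)"
  define B where "B = root p (y ^ p + v ^ p)"
  have AB: "A ^ p = x ^ p + u ^ p" "B ^ p = y ^ p + v ^ p" "0 \<le> A" "0 \<le> B"
    using p nn by (auto simp: A_def B_def)
  consider "A = 0" | "B = 0" | "A > 0" "B > 0" using AB by linarith
  then have "(x + y) ^ p + (u + v) ^ p \<le> (A + B) ^ p"
  proof cases
    case 1
    then have "x ^ p = 0" "u ^ p = 0"
      using AB(1) p nn by (simp_all add: add_nonneg_eq_0_iff power_0_left)
    then have "x = 0" "u = 0" by simp_all
    then show ?thesis using 1 AB by simp
  next
    case 2
    then have "y ^ p = 0" "v ^ p = 0"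
      using AB(2) p nn by (simp_all add: add_nonneg_eq_0_iff power_0_left)
    then have "y = 0" "v = 0" by simp_all
    then show ?thesis using 2 AB by simp
  next
    case 3
    define l where "l = A / (A + B)"
    have l: "0 \<le> l" "l \<le> 1" "1 - l = B / (A + B)"
      using 3 by (auto simp: l_def field_simps)
    have cv: "((a + b) / (A + B)) ^ p \<le> l * (a / A) ^ p + (1 - l) * (b / B) ^ p"
      if "0 \<le> a" "0 \<le> b" for a b
    proof -
      have "(a + b) / (A + B) = l * (a / A) + (1 - l) * (b / B)"
        using 3 unfolding l(3) by (simp add: l_def add_divide_distrib)
      moreover have "convex_on {0..} (\<lambda>z::real. z ^ p)"
        by (cases "even p") (auto intro: convex_power_odd convex_on_subset[OF convex_power_even])
      ultimately show ?thesis
        using convex_onD[of "{0..}" "\<lambda>z. z ^ p" "1 - l" "a / A" "b / B"] l(1,2) that 3 by simp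
    qed
    have "((x + y) / (A + B)) ^ p + ((u + v) / (A + B)) ^ p
        \<le> l * ((x / A) ^ p + (u / A) ^ p) + (1 - l) * ((y / B) ^ p + (v / B) ^ p)"
      using cv[OF nn(1,2)] cv[OF nn(3,4)] by (simp add: algebra_simps)
    also have "(x / A) ^ p + (u / A) ^ p = 1"
      using 3 by (simp add: power_divide flip: add_divide_distrib AB(1))
    also have "(y / B) ^ p + (v / B) ^ p = 1"
      using 3 by (simp add: power_divide flip: add_divide_distrib AB(2))
    finally show ?thesis
      using 3 by (simp add: power_divide flip: add_divide_distrib)
  qed
  then have "root p ((x + y) ^ p + (u + v) ^ p) \<le> root p ((A + B) ^ p)"
    using p by simp
  also have "\<dots> = A + B" using p AB by (simp add: real_root_power_cancel)
  finally show ?thesis by (simp add: A_def B_def)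
qed

lemma absolute_normalized_norm_Nc:
  assumes c: "0 < c" "c < 1" and n: "n \<ge> 1"
  shows "absolute_normalized_norm (Nc c n)"
proof -
  define p where "p = 2 * n"
  have p: "0 < p" using n by (simp add: p_def)
  define a where "a = root p (1 - c ^ p)"
  define h where "h = (\<lambda>s t. sqrt (s\<^sup>2 + c\<^sup>2 * t\<^sup>2))"
  have cp: "c ^ p < 1" using c p by (simp add: power_less_one_iff)
  have a: "a > 0" "a ^ p = 1 - c ^ p" using cp p by (auto simp: a_def)
  have h0: "0 \<le> h s t" for s t by (simp add: h_def)
  have hp: "h s t ^ p = (s\<^sup>2 + c\<^sup>2 * t\<^sup>2) ^ n" for s t
    by (simp add: h_def p_def power_mult)
  have eq: "Nc c n s t = root p ((a * \<bar>t\<bar>) ^ p + h s t ^ p)" for s t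
    by (simp add: Nc_def hp a power_mult_distrib flip: p_def)
  have hn: "h s t = norm (Complex s (c * t))" for s t
    by (simp add: h_def complex_norm power_mult_distrib)
  have ht: "h (s + s') (t + t') \<le> h s t + h s' t'" for s t s' t'
    using norm_triangle_ineq[of "Complex s (c * t)" "Complex s' (c * t')"]
    by (simp add: hn distrib_left complex_add)
  have h00: "h s t = 0 \<longleftrightarrow> s = 0 \<and> t = 0" for s t
    using c by (simp add: h_def add_nonneg_eq_0_iff)
  have hs: "h (b * s) (b * t) = \<bar>b\<bar> * h s t" for b s t
  proof -
    have "(b * s)\<^sup>2 + c\<^sup>2 * (b * t)\<^sup>2 = b\<^sup>2 * (s\<^sup>2 + c\<^sup>2 * t\<^sup>2)"
      by (simp add: power_mult_distrib algebra_simps)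
    then show ?thesis by (simp add: h_def real_sqrt_mult)
  qed
  show ?thesis
    unfolding absolute_normalized_norm_def
  proof (intro conjI allI)
    show "Nc c n s t = 0 \<longleftrightarrow> s = 0 \<and> t = 0" for s t
    proof -
      have "Nc c n s t = 0 \<longleftrightarrow> (a * \<bar>t\<bar>) ^ p + h s t ^ p = 0" using p by (simp add: eq)
      also have "\<dots> \<longleftrightarrow> (a * \<bar>t\<bar>) ^ p = 0 \<and> h s t ^ p = 0"
        using a h0 by (intro add_nonneg_eq_0_iff) auto
      also have "\<dots> \<longleftrightarrow> s = 0 \<and> t = 0" using a p h00 by auto
      finally show ?thesis .
    qed
    show "Nc c n (b * s) (b * t) = \<bar>b\<bar> * Nc c n s t" for b s t
    proof -
      have "(a * \<bar>b * t\<bar>) ^ p + h (b * s) (b * t) ^ p = \<bar>b\<bar> ^ p * ((a * \<bar>t\<bar>) ^ p + h s t ^ p)"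
        unfolding hs by (simp add: abs_mult power_mult_distrib algebra_simps)
      then show ?thesis
        using p by (simp add: eq real_root_mult real_root_power_cancel)
    qed
    show "Nc c n (s + s') (t + t') \<le> Nc c n s t + Nc c n s' t'" for s t s' t'
    proof -
      have "Nc c n (s + s') (t + t')
          \<le> root p ((a * \<bar>t\<bar> + a * \<bar>t'\<bar>) ^ p + (h s t + h s' t') ^ p)"
        unfolding eq using p a ht h0
        by (intro real_root_le_mono add_mono power_mono)
           (auto simp flip: distrib_left)
      also have "\<dots> \<le> Nc c n s t + Nc c n s' t'"
        unfolding eq using a h0 by (intro Minkowski_2 p) auto
      finally show ?thesis .
    qed
    show "Nc c n s t = Nc c n \<bar>s\<bar> \<bar>t\<bar>" for s t by (simp add: Nc_def)
    show "Nc c n 1 0 = 1" using n by (simp add: Nc_def)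
    show "Nc c n 0 1 = 1" using n by (simp add: Nc_def power_mult)
  qed
qed

definition Xspace :: "real \<Rightarrow> (nat \<Rightarrow> nat \<Rightarrow> real) set nspace"
  where "Xspace c = Aspace (Nc c)"

corollary banach_nspace_Xspace: "0 < c \<Longrightarrow> c < 1 \<Longrightarrow> banach_nspace (Xspace c)"
  unfolding Xspace_def by (intro banach_nspace_Aspace absolute_normalized_norm_Nc)

end

theory Submission
  imports Defs
begin

text \<open>
  Write \<open>N\<^sub>n\<close> for the two-dimensional norm \<open>Nc c n\<close>. It satisfies
  \<open>s\<^sup>2 + c\<^sup>2t\<^sup>2 \<le> N\<^sub>n(s,t)\<^sup>2 \<le> s\<^sup>2 + t\<^sup>2\<close> (\<open>Nc_lower\<close>, \<open>Nc_upper\<close>), so the norm of \<open>X\<^sub>c\<close>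
  lies between \<open>c\<close> times the Euclidean norm and the Euclidean norm. Hence \<open>X\<^sub>c\<close> is \<open>\<ell>\<^sub>2\<close> with an
  equivalent norm: sending \<open>y\<close> to the class of its truncations is an isomorphism of \<open>\<ell>\<^sub>2\<close> onto the
  completion (\<open>embed_op\<close>, \<open>embed_surj\<close>). Through it \<open>\<ell>\<^sub>2\<close> acts on \<open>X\<^sub>c\<close> by the inner product, and
  this identifies \<open>X\<^sub>c\<^sup>*\<close> with \<open>\<ell>\<^sub>2\<close> as well, again with constant \<open>1/c\<close> (\<open>functional_surj\<close>). Both
  distances are therefore at most \<open>1/c\<close>.

  For the lower bound let \<open>r\<^sub>n\<close> be the square of the norm of \<open>e\<^sub>0 + \<dots> + e\<^sub>n\<close>; signs do not change
  it, because the norms are absolute. As \<open>n\<close> grows, \<open>N\<^sub>n(s,1)\<^sup>2\<close> differs from \<open>s\<^sup>2 + c\<^sup>2\<close> by an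
  exponentially small amount when \<open>s \<ge> 1\<close> (\<open>Nc_step\<close>), whence \<open>r\<^sub>n \<le> c\<^sup>2n + O(1)\<close> (\<open>Nc_growth\<close>),
  although each \<open>e\<^sub>j\<close> is a unit vector. In a Hilbert space the parallelogram law gives, for any
  vectors \<open>w\<^sub>j\<close>, signs with \<open>\<parallel>\<Sum>\<plusminus>w\<^sub>j\<parallel>\<^sup>2 \<ge> \<Sum>\<parallel>w\<^sub>j\<parallel>\<^sup>2\<close> and signs with the reverse inequality
  (\<open>signs_ell2\<close>). If \<open>U\<close> is an isomorphism of \<open>X\<^sub>c\<close> onto \<open>\<ell>\<^sub>2\<close> and \<open>d = \<parallel>U\<parallel> \<parallel>U\<^sup>-\<^sup>1\<parallel>\<close>, the first choice
  with \<open>w\<^sub>j = U e\<^sub>j\<close> gives \<open>n + 1 \<le> d\<^sup>2r\<^sub>n\<close>, so \<open>d \<ge> 1/c\<close>. In the dual, the coordinate functionals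
  have norm at most one, and evaluating a signed sum of the first \<open>n + 1\<close> of them at the vector with
  the same signs shows that its squared norm is at least \<open>(n + 1)\<^sup>2/r\<^sub>n\<close>; the second choice of signs
  then leads to the same inequality \<open>n + 1 \<le> d\<^sup>2r\<^sub>n\<close>. Working with explicit functionals avoids any
  appeal to reflexivity.
\<close>

section \<open>Operators, distances and dual spaces\<close>

lemma real_nspace_real_line: "real_nspace real_line"
  by unfold_locales (auto simp: real_line_def diff_def algebra_simps abs_mult)

lemma op_norm_le:
  assumes "real_nspace E" "0 \<le> K" "\<And>x. x \<in> pts E \<Longrightarrow> nrm F (T x) \<le> K * nrm E x"
  shows "op_norm E F T \<le> K"
proof -
  interpret E: real_nspace E by fact
  have "zero E \<in> {x \<in> pts E. nrm E x \<le> 1}"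
    by (simp add: E.zero_closed E.nrm_zero)
  moreover have "nrm F (T x) \<le> K" if "x \<in> pts E" "nrm E x \<le> 1" for x
    using assms(3)[OF that(1)] mult_left_mono[OF that(2) assms(2)] by simp
  ultimately show ?thesis
    unfolding op_norm_def by (intro cSUP_least) auto
qed

lemma op_norm_upper:
  assumes "real_nspace E" "bounded_op E F T" "x \<in> pts E" "nrm E x \<le> 1"
  shows "nrm F (T x) \<le> op_norm E F T"
proof -
  interpret E: real_nspace E by fact
  obtain K where K: "\<And>x. x \<in> pts E \<Longrightarrow> nrm F (T x) \<le> K * nrm E x"
    using assms(2) unfolding bounded_op_def by blast
  have "nrm F (T x) \<le> \<bar>K\<bar>" if "x \<in> pts E" "nrm E x \<le> 1" for x
  proof -
    have "K * nrm E x \<le> \<bar>K\<bar> * 1"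
      using that E.nrm_nonneg[of x] by (intro mult_mono) auto
    then show ?thesis using K[OF that(1)] by simp
  qed
  then have "bdd_above ((\<lambda>x. nrm F (T x)) ` {x \<in> pts E. nrm E x \<le> 1})"
    by (intro bdd_aboveI2) auto
  then show ?thesis
    unfolding op_norm_def using assms by (intro cSUP_upper) auto
qed

lemma op_norm_nonneg:
  assumes "real_nspace E" "real_nspace F" "bounded_op E F T"
  shows "0 \<le> op_norm E F T"
proof -
  interpret E: real_nspace E by fact
  interpret F: real_nspace F by fact
  have "T (zero E) \<in> pts F"
    using assms(3) E.zero_closed by (auto simp: bounded_op_def)
  then show ?thesis
    using op_norm_upper[OF assms(1,3) E.zero_closed] F.nrm_nonneg[of "T (zero E)"]
    by (simp add: E.nrm_zero)
qed

lemma op_norm_bound: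
  assumes "real_nspace E" "real_nspace F" "bounded_op E F T" "x \<in> pts E"
  shows "nrm F (T x) \<le> op_norm E F T * nrm E x"
proof (cases "nrm E x = 0")
  case True
  obtain K where "\<And>x. x \<in> pts E \<Longrightarrow> nrm F (T x) \<le> K * nrm E x"
    using assms(3) unfolding bounded_op_def by blast
  from this[OF assms(4)] show ?thesis using True by simp
next
  case False
  interpret E: real_nspace E by fact
  interpret F: real_nspace F by fact
  define r where "r = nrm E x"
  have r: "r > 0" using False E.nrm_nonneg[OF assms(4)] by (simp add: r_def)
  have "nrm F (T (scl E (1 / r) x)) \<le> op_norm E F T"
    using assms r by (intro op_norm_upper) (auto simp: E.scl_closed E.nrm_scl simp flip: r_def)
  moreover have "nrm F (T (scl E (1 / r) x)) = nrm F (T x) / r"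
    using assms r by (auto simp: bounded_op_def F.nrm_scl)
  ultimately show ?thesis using r by (simp add: field_simps flip: r_def)
qed

lemma bounded_op_diff:
  assumes "real_nspace E" "bounded_op E F T" "x \<in> pts E" "y \<in> pts E"
  shows "T (diff E x y) = diff F (T x) (T y)"
  using assms real_nspace.scl_closed[OF assms(1)] by (simp add: diff_def bounded_op_def)

lemma inj_on_bounded_below:
  assumes "real_nspace E" "real_nspace F" "bounded_op E F T"
    and below: "\<And>x. x \<in> pts E \<Longrightarrow> nrm E x \<le> L * nrm F (T x)"
  shows "inj_on T (pts E)"
proof (rule inj_onI)
  interpret E: real_nspace E by fact
  interpret F: real_nspace F by fact
  fix x y assume xy: "x \<in> pts E" "y \<in> pts E" "T x = T y"
  have "T x \<in> pts F" using assms(3) xy by (simp add: bounded_op_def)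
  then have "nrm F (T (diff E x y)) = 0"
    using bounded_op_diff[OF assms(1,3) xy(1,2)] xy(3) by (simp add: F.diff_self F.nrm_zero)
  then have "nrm E (diff E x y) \<le> 0"
    using below[of "diff E x y"] xy by (simp add: E.diff_closed)
  then have "diff E x y = zero E"
    using E.nrm_nonneg[of "diff E x y"] E.nrm_eq_0[of "diff E x y"] xy
    by (simp add: E.diff_closed)
  then show "x = y"
    using E.add_diff_cancel[OF xy(1,2)] E.add_zero[OF xy(2)] by simp
qed

lemma bounded_op_comp:
  assumes "real_nspace F" "real_nspace G" "bounded_op E F T" "bounded_op F G V"
  shows "bounded_op E G (\<lambda>x. V (T x))"
proof -
  obtain K where K: "\<And>x. x \<in> pts E \<Longrightarrow> nrm F (T x) \<le> K * nrm E x"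
    using assms(3) unfolding bounded_op_def by blast
  have "nrm G (V (T x)) \<le> (op_norm F G V * K) * nrm E x" if x: "x \<in> pts E" for x
  proof -
    have "nrm G (V (T x)) \<le> op_norm F G V * nrm F (T x)"
      using assms x by (intro op_norm_bound) (auto simp: bounded_op_def)
    also have "\<dots> \<le> op_norm F G V * (K * nrm E x)"
      using K[OF x] op_norm_nonneg[OF assms(1,2,4)] by (rule mult_left_mono)
    finally show ?thesis by (simp add: mult.assoc)
  qed
  then have "\<exists>K. \<forall>x\<in>pts E. nrm G (V (T x)) \<le> K * nrm E x" by blast
  then show ?thesis using assms(3,4) by (simp add: bounded_op_def)
qed

text \<open>
  The operator is given in the direction \<open>F \<rightarrow> E\<close>, opposite to the isomorphisms in the definition of
  the distance: below, \<open>F\<close> is the sequence space, whose elements are explicit, and \<open>E\<close> a completion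
  or a dual, so that only the maps out of \<open>F\<close> have simple formulas.
\<close>

lemma bm_dist_le:
  assumes E: "real_nspace E" and F: "real_nspace F"
    and S: "bounded_op F E S" "S ` pts F = pts E"
    and K: "0 \<le> K" "\<And>y. y \<in> pts F \<Longrightarrow> nrm E (S y) \<le> K * nrm F y"
    and L: "0 \<le> L" "\<And>y. y \<in> pts F \<Longrightarrow> nrm F y \<le> L * nrm E (S y)"
  shows "bm_dist E F \<le> ereal (L * K)"
proof -
  interpret E: real_nspace E by fact
  interpret F: real_nspace F by fact
  have inj: "inj_on S (pts F)" using F E S(1) L(2) by (rule inj_on_bounded_below)
  define U where "U = inv_into (pts F) S"
  have US: "U (S y) = y" if "y \<in> pts F" for y using inj that by (simp add: U_def)
  have SU: "S (U x) = x" "U x \<in> pts F" if "x \<in> pts E" for x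
    using S(2) that by (auto simp: U_def f_inv_into_f inv_into_into)
  have bij: "bij_betw U (pts E) (pts F)"
    unfolding U_def using inj S(2) by (intro bij_betw_inv_into) (simp add: bij_betw_def)
  have V: "inv_into (pts E) U y = S y" if "y \<in> pts F" for y
    using that S(2) bij by (intro inv_into_f_eq) (auto simp: US bij_betw_def)
  have Sadd: "S (add F y z) = add E (S y) (S z)" if "y \<in> pts F" "z \<in> pts F" for y z
    using S(1) that by (simp add: bounded_op_def)
  have Sscl: "S (scl F a y) = scl E a (S y)" if "y \<in> pts F" for a y
    using S(1) that by (simp add: bounded_op_def)
  have Ub: "nrm F (U x) \<le> L * nrm E x" if "x \<in> pts E" for x
    using L(2)[OF SU(2)[OF that]] that by (simp add: SU)
  have "bounded_op E F U"
    unfolding bounded_op_def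
  proof (intro conjI ballI allI)
    fix x y assume xy: "x \<in> pts E" "y \<in> pts E"
    show "U (add E x y) = add F (U x) (U y)"
      using xy US[of "add F (U x) (U y)"] by (simp add: SU Sadd F.add_closed)
  next
    fix a x assume x: "x \<in> pts E"
    show "U (scl E a x) = scl F a (U x)"
      using x US[of "scl F a (U x)"] by (simp add: SU Sscl F.scl_closed)
  qed (use SU Ub in auto)
  moreover have "bounded_op F E (inv_into (pts E) U)"
    using S(1) by (auto simp: bounded_op_def V F.add_closed F.scl_closed)
  ultimately have iso: "isomorphism E F U" using bij by (simp add: isomorphism_def)
  have "op_norm E F U \<le> L" using Ub by (intro op_norm_le E L)
  moreover have "op_norm F E (inv_into (pts E) U) \<le> K"
    using K by (intro op_norm_le F) (simp_all add: V)
  ultimately have "op_norm E F U * op_norm F E (inv_into (pts E) U) \<le> L * K"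
    using iso E F L(1) by (intro mult_mono op_norm_nonneg) (auto simp: isomorphism_def)
  then show ?thesis
    unfolding bm_dist_def using iso by (intro INF_lower2[of U]) auto
qed

lemma in_dual: "f \<in> pts (dual E) \<longleftrightarrow> f \<in> extensional (pts E) \<and> bounded_op E real_line f"
  by (simp add: dual_def)

lemma nrm_dual: "nrm (dual E) = op_norm E real_line"
  by (simp add: dual_def)

lemma bounded_op_real_line:
  "bounded_op E real_line f \<longleftrightarrow>
    (\<forall>x\<in>pts E. \<forall>y\<in>pts E. f (add E x y) = f x + f y) \<and>
    (\<forall>a. \<forall>x\<in>pts E. f (scl E a x) = a * f x) \<and>
    (\<exists>K. \<forall>x\<in>pts E. \<bar>f x\<bar> \<le> K * nrm E x)"
  by (simp add: bounded_op_def real_line_def)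

lemma dual_bound:
  assumes "real_nspace E" "f \<in> pts (dual E)" "x \<in> pts E"
  shows "\<bar>f x\<bar> \<le> nrm (dual E) f * nrm E x"
  using op_norm_bound[OF assms(1) real_nspace_real_line, of f x] assms
  by (simp add: in_dual nrm_dual) (simp add: real_line_def)

lemma dual_norm_le:
  assumes "real_nspace E" "0 \<le> K" "\<And>x. x \<in> pts E \<Longrightarrow> \<bar>f x\<bar> \<le> K * nrm E x"
  shows "nrm (dual E) f \<le> K"
  unfolding nrm_dual using assms by (intro op_norm_le) (auto simp: real_line_def)

lemma real_nspace_dual:
  assumes "real_nspace E"
  shows "real_nspace (dual E)"
proof -
  interpret E: real_nspace E by fact
  have ops: "add (dual E) = (\<lambda>f g. \<lambda>x\<in>pts E. f x + g x)" "zero (dual E) = (\<lambda>x\<in>pts E. 0)"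
    "scl (dual E) = (\<lambda>a f. \<lambda>x\<in>pts E. a * f x)"
    by (simp_all add: dual_def)
  have nn: "0 \<le> nrm (dual E) f" if "f \<in> pts (dual E)" for f
    using op_norm_nonneg[OF assms real_nspace_real_line] that by (simp add: in_dual nrm_dual)
  have ext: "f = g" if "f \<in> pts (dual E)" "g \<in> extensional (pts E)"
    "\<And>x. x \<in> pts E \<Longrightarrow> f x = g x" for f g
    using that by (intro extensionalityI[of _ "pts E"]) (auto simp: in_dual)
  have addc: "add (dual E) f g \<in> pts (dual E)" if fg: "f \<in> pts (dual E)" "g \<in> pts (dual E)" for f g
  proof -
    have "\<bar>f x + g x\<bar> \<le> (nrm (dual E) f + nrm (dual E) g) * nrm E x" if "x \<in> pts E" for x
      using dual_bound[OF assms fg(1) that] dual_bound[OF assms fg(2) that]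
        abs_triangle_ineq[of "f x" "g x"] by (simp add: distrib_right)
    then have "\<exists>K. \<forall>x\<in>pts E. \<bar>f x + g x\<bar> \<le> K * nrm E x" by blast
    then show ?thesis
      using fg by (simp add: in_dual ops bounded_op_real_line E.add_closed E.scl_closed
          distrib_left)
  qed
  have sb: "\<bar>a * f x\<bar> \<le> (\<bar>a\<bar> * nrm (dual E) f) * nrm E x"
    if f: "f \<in> pts (dual E)" "x \<in> pts E" for f a x
    using mult_left_mono[OF dual_bound[OF assms f], of "\<bar>a\<bar>"]
    by (simp add: abs_mult mult.assoc)
  have sclc: "scl (dual E) a f \<in> pts (dual E)" if f: "f \<in> pts (dual E)" for f a
  proof -
    have "\<exists>K. \<forall>x\<in>pts E. \<bar>a * f x\<bar> \<le> K * nrm E x" using sb[OF f, of _ a] by blast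
    then show ?thesis
      using f by (simp add: in_dual ops bounded_op_real_line E.add_closed E.scl_closed
          distrib_left)
  qed
  have scln: "nrm (dual E) (scl (dual E) a f) \<le> \<bar>a\<bar> * nrm (dual E) f"
    if f: "f \<in> pts (dual E)" for f a
    using sb[OF f] nn[OF f] by (intro dual_norm_le[OF assms]) (auto simp: ops)
  show ?thesis
  proof
    fix f g assume fg: "f \<in> pts (dual E)" "g \<in> pts (dual E)"
    show "add (dual E) f g \<in> pts (dual E)" by (rule addc[OF fg])
    show "nrm (dual E) (add (dual E) f g) \<le> nrm (dual E) f + nrm (dual E) g"
    proof (rule dual_norm_le[OF assms])
      fix x assume x: "x \<in> pts E"
      show "\<bar>add (dual E) f g x\<bar> \<le> (nrm (dual E) f + nrm (dual E) g) * nrm E x"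
        using dual_bound[OF assms fg(1) x] dual_bound[OF assms fg(2) x] x
        by (simp add: ops algebra_simps)
    qed (use nn fg in auto)
  next
    fix f a assume f: "f \<in> pts (dual E)"
    show "scl (dual E) a f \<in> pts (dual E)" by (rule sclc[OF f])
    show "nrm (dual E) (scl (dual E) a f) = \<bar>a\<bar> * nrm (dual E) f"
    proof (cases "a = 0")
      case True
      then show ?thesis using scln[OF f, of 0] nn[OF sclc[OF f, of 0]] by simp
    next
      case False
      have "f = scl (dual E) (1 / a) (scl (dual E) a f)"
        using False by (intro ext f) (auto simp: ops)
      then have "nrm (dual E) f \<le> \<bar>1 / a\<bar> * nrm (dual E) (scl (dual E) a f)"
        using scln[OF sclc[OF f], of "1 / a" a] by simp
      then show ?thesis using scln[OF f, of a] False by (simp add: field_simps)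
    qed
  next
    show "zero (dual E) \<in> pts (dual E)"
      by (auto simp: in_dual ops bounded_op_real_line E.add_closed E.scl_closed intro!: exI[of _ 0])
    fix f assume f: "f \<in> pts (dual E)"
    show "add (dual E) f (zero (dual E)) = f"
      by (rule ext[OF f, symmetric]) (auto simp: ops)
    show "scl (dual E) 1 f = f"
      by (rule ext[OF f, symmetric]) (auto simp: ops)
    show "nrm (dual E) f = 0 \<longleftrightarrow> f = zero (dual E)"
    proof
      assume "nrm (dual E) f = 0"
      then show "f = zero (dual E)"
        using dual_bound[OF assms f] by (intro ext f) (auto simp: ops)
    next
      assume "f = zero (dual E)"
      then have "nrm (dual E) f \<le> 0" by (intro dual_norm_le[OF assms]) (auto simp: ops)
      then show "nrm (dual E) f = 0" using nn[OF f] by simp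
    qed
  qed (auto simp: ops diff_def algebra_simps restrict_def fun_eq_iff)
qed


section \<open>The space of square-summable sequences\<close>

lemma ell2_ops:
  "pts ell2 = {x. summable (\<lambda>j. (x j)\<^sup>2)}" "add ell2 = (\<lambda>x y j. x j + y j)"
  "zero ell2 = (\<lambda>j. 0)" "scl ell2 = (\<lambda>a x j. a * x j)"
  by (simp_all add: ell2_def)

lemma diff_ell2: "diff ell2 x y = (\<lambda>j. x j - y j)"
  by (simp add: diff_def ell2_ops)

lemma nrm_ell2: "nrm ell2 x = sqrt (\<Sum>j. (x j)\<^sup>2)"
  by (simp add: ell2_def)

lemma nrm_ell2_nonneg: "x \<in> pts ell2 \<Longrightarrow> 0 \<le> nrm ell2 x"
  by (simp add: nrm_ell2 ell2_ops suminf_nonneg)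

lemma nrm_ell2_sq: "x \<in> pts ell2 \<Longrightarrow> (nrm ell2 x)\<^sup>2 = (\<Sum>j. (x j)\<^sup>2)"
  by (simp add: nrm_ell2 ell2_ops suminf_nonneg)

lemma L2_set_le_nrm_ell2:
  assumes "x \<in> pts ell2" "finite A" shows "L2_set x A \<le> nrm ell2 x"
  using assms unfolding L2_set_def nrm_ell2
  by (intro real_sqrt_le_mono sum_le_suminf) (auto simp: ell2_ops)

text \<open>
  Bounding all finite sections yields summability and the norm estimate at once; this is how the
  triangle inequality, completeness and the representation of functionals obtain membership.
\<close>

lemma ell2I:
  assumes "\<And>n. L2_set x {..<n} \<le> B"
  shows "x \<in> pts ell2" "nrm ell2 x \<le> B"
proof -
  have B: "0 \<le> B" using assms[of 0] by simp
  have *: "(\<Sum>j<n. (x j)\<^sup>2) \<le> B\<^sup>2" for n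
    using assms[of n] B by (simp add: L2_set_def real_le_lsqrt sqrt_le_D sum_nonneg)
  then have s: "summable (\<lambda>j. (x j)\<^sup>2)" by (intro summableI_nonneg_bounded) auto
  then show "x \<in> pts ell2" by (simp add: ell2_ops)
  have "(\<Sum>j. (x j)\<^sup>2) \<le> B\<^sup>2" using s * by (rule suminf_le_const)
  then show "nrm ell2 x \<le> B" using B by (simp add: nrm_ell2 real_le_lsqrt)
qed

lemma add_ell2:
  assumes "x \<in> pts ell2" "y \<in> pts ell2"
  shows "(\<lambda>j. x j + y j) \<in> pts ell2" "nrm ell2 (\<lambda>j. x j + y j) \<le> nrm ell2 x + nrm ell2 y"
proof -
  have "L2_set (\<lambda>j. x j + y j) {..<n} \<le> nrm ell2 x + nrm ell2 y" for n
    using L2_set_triangle_ineq[of x y "{..<n}"] L2_set_le_nrm_ell2[OF assms(1), of "{..<n}"]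
      L2_set_le_nrm_ell2[OF assms(2), of "{..<n}"] by simp
  then show "(\<lambda>j. x j + y j) \<in> pts ell2" "nrm ell2 (\<lambda>j. x j + y j) \<le> nrm ell2 x + nrm ell2 y"
    by (rule ell2I)+
qed

lemma scl_ell2:
  assumes "x \<in> pts ell2"
  shows "(\<lambda>j. a * x j) \<in> pts ell2" "nrm ell2 (\<lambda>j. a * x j) = \<bar>a\<bar> * nrm ell2 x"
  using assms suminf_mult[of "\<lambda>j. (x j)\<^sup>2" "a\<^sup>2"]
  by (auto simp: ell2_ops nrm_ell2 power_mult_distrib summable_mult real_sqrt_mult)

lemma real_nspace_ell2: "real_nspace ell2"
proof
  fix x assume x: "x \<in> pts ell2"
  show "nrm ell2 x = 0 \<longleftrightarrow> x = zero ell2"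
    using x suminf_eq_zero_iff[of "\<lambda>j. (x j)\<^sup>2"] by (auto simp: nrm_ell2 ell2_ops)
qed (auto simp: add_ell2 scl_ell2 ell2_ops(2-) diff_ell2 algebra_simps, simp add: ell2_ops)

lemma parallelogram_ell2:
  assumes "x \<in> pts ell2" "y \<in> pts ell2"
  shows "(nrm ell2 (\<lambda>j. x j + y j))\<^sup>2 + (nrm ell2 (\<lambda>j. x j - y j))\<^sup>2
    = 2 * ((nrm ell2 x)\<^sup>2 + (nrm ell2 y)\<^sup>2)"
proof -
  have d: "(\<lambda>j. x j - y j) \<in> pts ell2"
    using real_nspace.diff_closed[OF real_nspace_ell2 assms] by (simp add: diff_ell2)
  have "(nrm ell2 (\<lambda>j. x j + y j))\<^sup>2 + (nrm ell2 (\<lambda>j. x j - y j))\<^sup>2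
      = (\<Sum>j. (x j + y j)\<^sup>2 + (x j - y j)\<^sup>2)"
    using add_ell2(1)[OF assms] d
    by (subst suminf_add[symmetric]) (auto simp: nrm_ell2_sq ell2_ops)
  also have "\<dots> = (\<Sum>j. 2 * ((x j)\<^sup>2 + (y j)\<^sup>2))"
    by (intro suminf_cong) (simp add: power2_eq_square algebra_simps)
  also have "\<dots> = 2 * ((nrm ell2 x)\<^sup>2 + (nrm ell2 y)\<^sup>2)"
    using assms
    by (subst suminf_mult) (auto simp: nrm_ell2_sq ell2_ops suminf_add intro: summable_add)
  finally show ?thesis .
qed

definition inner2 :: "(nat \<Rightarrow> real) \<Rightarrow> (nat \<Rightarrow> real) \<Rightarrow> real"
  where "inner2 x y = (\<Sum>j. x j * y j)"

lemma inner2: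
  assumes "x \<in> pts ell2" "y \<in> pts ell2"
  shows summable_inner2: "summable (\<lambda>j. x j * y j)"
    and Cauchy_Schwarz_ell2: "\<bar>inner2 x y\<bar> \<le> nrm ell2 x * nrm ell2 y"
proof -
  have *: "(\<Sum>j<n. \<bar>x j * y j\<bar>) \<le> nrm ell2 x * nrm ell2 y" for n
  proof -
    have "(\<Sum>j<n. \<bar>x j * y j\<bar>) \<le> L2_set x {..<n} * L2_set y {..<n}"
      using L2_set_mult_ineq[of x y "{..<n}"] by (simp add: abs_mult)
    also have "\<dots> \<le> nrm ell2 x * nrm ell2 y"
      using assms by (intro mult_mono L2_set_le_nrm_ell2) (auto simp: nrm_ell2_nonneg)
    finally show ?thesis .
  qed
  then have s: "summable (\<lambda>j. \<bar>x j * y j\<bar>)" by (intro summableI_nonneg_bounded) auto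
  then show "summable (\<lambda>j. x j * y j)" by (rule summable_rabs_cancel)
  have "\<bar>inner2 x y\<bar> \<le> (\<Sum>j. \<bar>x j * y j\<bar>)" unfolding inner2_def by (rule summable_rabs[OF s])
  also have "\<dots> \<le> nrm ell2 x * nrm ell2 y" using s * by (rule suminf_le_const)
  finally show "\<bar>inner2 x y\<bar> \<le> nrm ell2 x * nrm ell2 y" .
qed

lemma inner2_self: "x \<in> pts ell2 \<Longrightarrow> inner2 x x = (nrm ell2 x)\<^sup>2"
  unfolding nrm_ell2_sq inner2_def by (simp add: power2_eq_square)

lemma inner2_linear:
  assumes "x \<in> pts ell2" "y \<in> pts ell2" "z \<in> pts ell2"
  shows "inner2 z (\<lambda>j. x j + y j) = inner2 z x + inner2 z y"
    and "inner2 (\<lambda>j. x j + y j) z = inner2 x z + inner2 y z"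
    and "inner2 z (\<lambda>j. a * x j) = a * inner2 z x"
    and "inner2 (\<lambda>j. a * x j) z = a * inner2 x z"
  using assms summable_inner2
  by (simp_all add: inner2_def distrib_left distrib_right suminf_add mult.assoc
      mult.left_commute[of _ a] suminf_mult)

definition cut :: "nat \<Rightarrow> (nat \<Rightarrow> real) \<Rightarrow> nat \<Rightarrow> real"
  where "cut n x = (\<lambda>j. if j \<le> n then x j else 0)"

definition unitv :: "nat \<Rightarrow> nat \<Rightarrow> real"
  where "unitv k = (\<lambda>j. if j = k then 1 else 0)"

lemma finite_support_ell2:
  assumes "\<forall>j>n. x j = 0"
  shows "x \<in> pts ell2" "(nrm ell2 x)\<^sup>2 = (\<Sum>j\<le>n. (x j)\<^sup>2)"
proof -
  have "(\<lambda>j. (x j)\<^sup>2) sums (\<Sum>j\<le>n. (x j)\<^sup>2)"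
    using assms by (intro sums_finite) auto
  then show "x \<in> pts ell2" "(nrm ell2 x)\<^sup>2 = (\<Sum>j\<le>n. (x j)\<^sup>2)"
    by (auto simp: nrm_ell2_sq ell2_ops sums_iff)
qed

lemma cut_zero: "j > n \<Longrightarrow> cut n x j = 0"
  by (simp add: cut_def)

lemma cut_ell2: "cut n x \<in> pts ell2" "(nrm ell2 (cut n x))\<^sup>2 = (\<Sum>j\<le>n. (x j)\<^sup>2)"
  using finite_support_ell2[of n "cut n x"] by (simp_all add: cut_def)

lemma unitv_ell2: "unitv k \<in> pts ell2"
  using finite_support_ell2(1)[of k] by (simp add: unitv_def)

lemma cut_0: "cut 0 x = scl ell2 (x 0) (unitv 0)"
  by (auto simp: cut_def unitv_def ell2_ops)

lemma cut_Suc: "cut (Suc n) x = add ell2 (cut n x) (scl ell2 (x (Suc n)) (unitv (Suc n)))"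
  by (auto simp: cut_def unitv_def ell2_ops fun_eq_iff le_Suc_eq)

lemma inner2_unitv: "inner2 (unitv k) x = x k"
  using suminf_finite[of "{k}" "\<lambda>j. unitv k j * x j"]
  by (simp add: inner2_def unitv_def)

lemma cut_tendsto:
  assumes "x \<in> pts ell2"
  shows "(\<lambda>n. nrm ell2 (diff ell2 (cut n x) x)) \<longlonglongrightarrow> 0"
proof -
  have s: "summable (\<lambda>j. (x j)\<^sup>2)" using assms by (simp add: ell2_ops)
  have "(nrm ell2 (diff ell2 (cut n x) x))\<^sup>2 = (\<Sum>j. (x j)\<^sup>2) - (\<Sum>j\<le>n. (x j)\<^sup>2)" for n
  proof -
    have "diff ell2 (cut n x) x \<in> pts ell2"
      by (intro real_nspace.diff_closed real_nspace_ell2 cut_ell2 assms)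
    moreover have "(diff ell2 (cut n x) x j)\<^sup>2 = (x j)\<^sup>2 - (cut n x j)\<^sup>2" for j
      by (simp add: diff_ell2 cut_def)
    ultimately show ?thesis
      using suminf_diff[OF s, of "\<lambda>j. (cut n x j)\<^sup>2"] cut_ell2[of n x]
      by (simp add: nrm_ell2_sq) (simp add: ell2_ops)
  qed
  moreover have "(\<lambda>n. (\<Sum>j. (x j)\<^sup>2) - (\<Sum>j\<le>n. (x j)\<^sup>2)) \<longlonglongrightarrow> (\<Sum>j. (x j)\<^sup>2) - (\<Sum>j. (x j)\<^sup>2)"
    by (intro tendsto_intros summable_LIMSEQ'[OF s])
  ultimately have "(\<lambda>n. (nrm ell2 (diff ell2 (cut n x) x))\<^sup>2) \<longlonglongrightarrow> 0" by simp
  from tendsto_real_sqrt[OF this] show ?thesis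
    using nrm_ell2_nonneg[OF real_nspace.diff_closed[OF real_nspace_ell2 cut_ell2(1) assms]]
    by simp
qed

text \<open>
  The coordinatewise limit is the limit in norm: a bound on the finite sections of
  \<open>x\<^sub>n - x\<^sub>m\<close> survives \<open>m \<rightarrow> \<infinity>\<close>, and the bound does not depend on the section.
\<close>

lemma complete_ell2:
  assumes x: "x \<in> Cauchy_seqs ell2"
  obtains y where "y \<in> pts ell2" "(\<lambda>n. nrm ell2 (diff ell2 (x n) y)) \<longlonglongrightarrow> 0"
proof -
  interpret real_nspace ell2 by (rule real_nspace_ell2)
  have xp: "x n \<in> pts ell2" for n by (rule Cauchy_pts[OF x])
  have "Cauchy (\<lambda>n. x n j)" for j
  proof (rule metric_CauchyI)
    fix e :: real assume "e > 0"
    then obtain k where k: "\<And>m n. m \<ge> k \<Longrightarrow> n \<ge> k \<Longrightarrow> nrm ell2 (diff ell2 (x m) (x n)) < e"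
      using Cauchy_E[OF x] by blast
    have coord: "\<bar>x m j - x n j\<bar> \<le> nrm ell2 (diff ell2 (x m) (x n))" for m n
      using L2_set_le_nrm_ell2[OF diff_closed[OF xp xp], of "{j}" m n]
      by (simp add: diff_ell2)
    then show "\<exists>M. \<forall>m\<ge>M. \<forall>n\<ge>M. dist (x m j) (x n j) < e"
      by (intro exI[of _ k] allI impI) (simp add: dist_real_def le_less_trans[OF coord k])
  qed
  then have "\<forall>j. \<exists>l. (\<lambda>n. x n j) \<longlonglongrightarrow> l"
    by (simp add: real_Cauchy_convergent flip: convergent_def)
  then obtain y where y: "\<And>j. (\<lambda>n. x n j) \<longlonglongrightarrow> y j" by metis
  have close: "\<exists>k. \<forall>n\<ge>k. \<forall>N. L2_set (diff ell2 (x n) y) {..<N} \<le> e" if e: "e > 0" for e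
  proof -
    obtain k where k: "\<And>m n. m \<ge> k \<Longrightarrow> n \<ge> k \<Longrightarrow> nrm ell2 (diff ell2 (x m) (x n)) < e"
      using Cauchy_E[OF x e] by blast
    have "L2_set (diff ell2 (x n) y) {..<N} \<le> e" if n: "n \<ge> k" for n N
    proof (rule LIMSEQ_le_const2)
      show "(\<lambda>m. L2_set (diff ell2 (x n) (x m)) {..<N}) \<longlonglongrightarrow> L2_set (diff ell2 (x n) y) {..<N}"
        unfolding L2_set_def diff_ell2 by (intro tendsto_intros y)
      have "L2_set (diff ell2 (x n) (x m)) {..<N} \<le> e" if "m \<ge> k" for m
        using L2_set_le_nrm_ell2[OF diff_closed[OF xp xp], of "{..<N}" n m] k[OF n that] by simp
      then show "\<exists>k. \<forall>m\<ge>k. L2_set (diff ell2 (x n) (x m)) {..<N} \<le> e" by blast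
    qed
    then show ?thesis by blast
  qed
  \<comment> \<open>Already one difference in \<open>\<ell>\<^sub>2\<close> puts the limit there.\<close>
  obtain k where "\<And>N. L2_set (diff ell2 (x k) y) {..<N} \<le> 1"
    using close[of 1] by auto
  then have d: "diff ell2 (x k) y \<in> pts ell2" by (rule ell2I)
  have "y = diff ell2 (x k) (diff ell2 (x k) y)" by (simp add: diff_ell2)
  with diff_closed[OF xp d, of k] have yp: "y \<in> pts ell2" by simp
  have "(\<lambda>n. nrm ell2 (diff ell2 (x n) y)) \<longlonglongrightarrow> 0"
  proof (rule LIMSEQ_I)
    fix e :: real assume e: "e > 0"
    then obtain k where k: "\<And>n N. n \<ge> k \<Longrightarrow> L2_set (diff ell2 (x n) y) {..<N} \<le> e / 2"
      using close[of "e / 2"] by auto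
    have "nrm ell2 (diff ell2 (x n) y) \<le> e / 2" if "n \<ge> k" for n
      using k[OF that] by (rule ell2I(2))
    then show "\<exists>k. \<forall>n\<ge>k. norm (nrm ell2 (diff ell2 (x n) y) - 0) < e"
      using e nrm_nonneg[OF diff_closed[OF xp yp]] by (intro exI[of _ k]) force
  qed
  with yp show ?thesis by (rule that)
qed


section \<open>Lower bounds from signed sums\<close>

text \<open>
  By the parallelogram law the average of \<open>\<parallel>x + y\<parallel>\<^sup>2\<close> and \<open>\<parallel>x - y\<parallel>\<^sup>2\<close> is \<open>\<parallel>x\<parallel>\<^sup>2 + \<parallel>y\<parallel>\<^sup>2\<close>, so signs
  can be chosen one at a time, in favour of either inequality. The factor \<open>\<sigma>\<close> selects the
  inequality: \<open>\<sigma> = 1\<close> makes the signed sum long, \<open>\<sigma> = -1\<close> makes it short.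
\<close>

lemma signs_ell2:
  assumes W: "bounded_op ell2 ell2 W"
  shows "\<exists>\<epsilon>. (\<forall>j. \<bar>\<epsilon> j\<bar> = 1) \<and>
    0 \<le> \<sigma> * ((nrm ell2 (W (cut n \<epsilon>)))\<^sup>2 - (\<Sum>j\<le>n. (nrm ell2 (W (unitv j)))\<^sup>2))"
proof (induction n)
  case 0
  have "cut 0 (\<lambda>_. 1) = unitv 0" by (simp add: cut_0 ell2_ops)
  then show ?case by (intro exI[of _ "\<lambda>_. 1"]) simp
next
  case (Suc n)
  then obtain \<epsilon> where \<epsilon>: "\<And>j. \<bar>\<epsilon> j\<bar> = 1"
    and IH: "0 \<le> \<sigma> * ((nrm ell2 (W (cut n \<epsilon>)))\<^sup>2 - (\<Sum>j\<le>n. (nrm ell2 (W (unitv j)))\<^sup>2))"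
    by blast
  define x where "x = W (cut n \<epsilon>)"
  define y where "y = W (unitv (Suc n))"
  have xy: "x \<in> pts ell2" "y \<in> pts ell2"
    using W cut_ell2(1) unitv_ell2 by (auto simp: x_def y_def bounded_op_def)
  have W_cut: "W (cut (Suc n) (\<epsilon>(Suc n := s))) = (\<lambda>j. x j + s * y j)" for s
  proof -
    have "cut n (\<epsilon>(Suc n := s)) = cut n \<epsilon>" by (auto simp: cut_def)
    then show ?thesis
      using W cut_ell2(1) unitv_ell2 real_nspace.scl_closed[OF real_nspace_ell2 unitv_ell2]
      by (simp add: cut_Suc bounded_op_def x_def y_def) (simp add: ell2_ops)
  qed
  define D where "D s = \<sigma> * ((nrm ell2 (\<lambda>j. x j + s * y j))\<^sup>2 - ((nrm ell2 x)\<^sup>2 + (nrm ell2 y)\<^sup>2))" for s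
  \<comment> \<open>The two defects cancel by the parallelogram law, so one of them is nonnegative.\<close>
  have "D 1 + D (-1) = 0"
  proof -
    have "D 1 + D (-1) = \<sigma> * ((nrm ell2 (\<lambda>j. x j + y j))\<^sup>2 + (nrm ell2 (\<lambda>j. x j - y j))\<^sup>2
        - 2 * ((nrm ell2 x)\<^sup>2 + (nrm ell2 y)\<^sup>2))"
      by (simp add: D_def algebra_simps)
    then show ?thesis unfolding parallelogram_ell2[OF xy] by simp
  qed
  then obtain s where s: "\<bar>s\<bar> = 1" "0 \<le> D s"
    by (cases "0 \<le> D 1") (auto intro: that[of 1] that[of "-1"])
  have "\<forall>j. \<bar>(\<epsilon>(Suc n := s)) j\<bar> = 1" using \<epsilon> s by simp
  moreover have "0 \<le> \<sigma> * ((nrm ell2 (W (cut (Suc n) (\<epsilon>(Suc n := s)))))\<^sup>2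
      - (\<Sum>j\<le>Suc n. (nrm ell2 (W (unitv j)))\<^sup>2))"
  proof -
    have "\<sigma> * ((nrm ell2 (\<lambda>j. x j + s * y j))\<^sup>2 - (\<Sum>j\<le>Suc n. (nrm ell2 (W (unitv j)))\<^sup>2))
        = D s + \<sigma> * ((nrm ell2 x)\<^sup>2 - (\<Sum>j\<le>n. (nrm ell2 (W (unitv j)))\<^sup>2))"
      by (simp add: D_def y_def[symmetric] right_diff_distrib distrib_left)
    then show ?thesis using IH s(2) by (simp only: W_cut x_def[symmetric] add_nonneg_nonneg)
  qed
  ultimately show ?case by (intro exI conjI)
qed

lemma isomorphism_bounds:
  assumes E: "real_nspace E" and F: "real_nspace F" and U: "isomorphism E F U"
  shows "0 \<le> op_norm E F U" "0 \<le> op_norm F E (inv_into (pts E) U)"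
    and "x \<in> pts E \<Longrightarrow> U x \<in> pts F"
    and "x \<in> pts E \<Longrightarrow> nrm F (U x) \<le> op_norm E F U * nrm E x"
    and "x \<in> pts E \<Longrightarrow> nrm E x \<le> op_norm F E (inv_into (pts E) U) * nrm F (U x)"
proof -
  have b: "bounded_op E F U" "bounded_op F E (inv_into (pts E) U)"
    and bij: "bij_betw U (pts E) (pts F)"
    using U by (auto simp: isomorphism_def)
  show "0 \<le> op_norm E F U" "0 \<le> op_norm F E (inv_into (pts E) U)"
    using op_norm_nonneg E F b by blast+
  assume x: "x \<in> pts E"
  show Ux: "U x \<in> pts F" using b(1) x by (simp add: bounded_op_def)
  show "nrm F (U x) \<le> op_norm E F U * nrm E x" by (rule op_norm_bound[OF E F b(1) x])
  show "nrm E x \<le> op_norm F E (inv_into (pts E) U) * nrm F (U x)"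
    using op_norm_bound[OF F E b(2) Ux] bij_betw_inv_into_left[OF bij x] by simp
qed

text \<open>
  If signed sums of the images of the unit vectors are short in \<open>E\<close>, then every isomorphism onto the
  Hilbert space is distorted, because there some signed sum is as long as in the orthogonal case.
\<close>

lemma isomorphism_sum_le:
  assumes E: "real_nspace E" and I: "bounded_op ell2 E I" and U: "isomorphism E ell2 U"
    and unit: "\<And>j. 1 \<le> nrm E (I (unitv j))"
    and signed: "\<And>\<epsilon>. (\<forall>j. \<bar>\<epsilon> j\<bar> = 1) \<Longrightarrow> (nrm E (I (cut n \<epsilon>)))\<^sup>2 \<le> R"
  shows "real n + 1 \<le> (op_norm E ell2 U * op_norm ell2 E (inv_into (pts E) U))\<^sup>2 * R"
proof -
  define K where "K = op_norm E ell2 U"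
  define L where "L = op_norm ell2 E (inv_into (pts E) U)"
  note KL = isomorphism_bounds(1,2)[OF E real_nspace_ell2 U, folded K_def L_def]
  note Up = isomorphism_bounds(3-5)[OF E real_nspace_ell2 U, folded K_def L_def]
  have b: "bounded_op E ell2 U" using U by (simp add: isomorphism_def)
  have Ip: "I y \<in> pts E" if "y \<in> pts ell2" for y
    using I that by (simp add: bounded_op_def)
  obtain \<epsilon> where \<epsilon>: "\<forall>j. \<bar>\<epsilon> j\<bar> = 1"
    "(\<Sum>j\<le>n. (nrm ell2 (U (I (unitv j))))\<^sup>2) \<le> (nrm ell2 (U (I (cut n \<epsilon>))))\<^sup>2"
    using signs_ell2[OF bounded_op_comp[OF E real_nspace_ell2 I b], where \<sigma> = 1] by auto
  have "real n + 1 = (\<Sum>j\<le>n. 1\<^sup>2)" by simp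
  also have "\<dots> \<le> (\<Sum>j\<le>n. (L * nrm ell2 (U (I (unitv j))))\<^sup>2)"
    using order_trans[OF unit Up(3)[OF Ip[OF unitv_ell2]]] by (intro sum_mono power_mono) auto
  also have "\<dots> \<le> L\<^sup>2 * (nrm ell2 (U (I (cut n \<epsilon>))))\<^sup>2"
    using mult_left_mono[OF \<epsilon>(2), of "L\<^sup>2"] by (simp add: power_mult_distrib sum_distrib_left)
  also have "\<dots> \<le> L\<^sup>2 * (K * nrm E (I (cut n \<epsilon>)))\<^sup>2"
    by (intro mult_left_mono power_mono nrm_ell2_nonneg Up Ip cut_ell2) auto
  also have "\<dots> = (K * L)\<^sup>2 * (nrm E (I (cut n \<epsilon>)))\<^sup>2" by (simp add: power_mult_distrib)
  also have "\<dots> \<le> (K * L)\<^sup>2 * R" using signed[OF \<epsilon>(1)] by (intro mult_left_mono) auto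
  finally show ?thesis by (simp add: K_def L_def)
qed

text \<open>
  The counterpart of the preceding lemma for long signed sums, in the form that suits the dual: the
  length of a signed sum enters through the lower bound \<open>(n + 1)\<^sup>2/R\<close> for its square.
\<close>

lemma isomorphism_sum_ge:
  assumes E: "real_nspace E" and I: "bounded_op ell2 E I" and U: "isomorphism E ell2 U"
    and unit: "\<And>j. nrm E (I (unitv j)) \<le> 1"
    and signed: "\<And>\<epsilon>. (\<forall>j. \<bar>\<epsilon> j\<bar> = 1) \<Longrightarrow> (real n + 1)\<^sup>2 \<le> R * (nrm E (I (cut n \<epsilon>)))\<^sup>2"
    and R: "0 \<le> R"
  shows "real n + 1 \<le> (op_norm E ell2 U * op_norm ell2 E (inv_into (pts E) U))\<^sup>2 * R"
proof -
  interpret E: real_nspace E by fact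
  define K where "K = op_norm E ell2 U"
  define L where "L = op_norm ell2 E (inv_into (pts E) U)"
  note KL = isomorphism_bounds(1,2)[OF E real_nspace_ell2 U, folded K_def L_def]
  note Up = isomorphism_bounds(3-5)[OF E real_nspace_ell2 U, folded K_def L_def]
  have b: "bounded_op E ell2 U" using U by (simp add: isomorphism_def)
  have Ip: "I y \<in> pts E" if "y \<in> pts ell2" for y
    using I that by (simp add: bounded_op_def)
  obtain \<epsilon> where \<epsilon>: "\<forall>j. \<bar>\<epsilon> j\<bar> = 1"
    "(nrm ell2 (U (I (cut n \<epsilon>))))\<^sup>2 \<le> (\<Sum>j\<le>n. (nrm ell2 (U (I (unitv j))))\<^sup>2)"
    using signs_ell2[OF bounded_op_comp[OF E real_nspace_ell2 I b], where \<sigma> = "-1"] by auto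
  have "(nrm ell2 (U (I (unitv j))))\<^sup>2 \<le> K\<^sup>2" for j
  proof (rule power_mono)
    show "nrm ell2 (U (I (unitv j))) \<le> K"
      using Up(2)[OF Ip[OF unitv_ell2]] mult_left_mono[OF unit KL(1), of j] by (auto intro: order_trans)
    show "0 \<le> nrm ell2 (U (I (unitv j)))"
      by (intro nrm_ell2_nonneg Up Ip unitv_ell2)
  qed
  then have "(\<Sum>j\<le>n. (nrm ell2 (U (I (unitv j))))\<^sup>2) \<le> (real n + 1) * K\<^sup>2"
    using sum_bounded_above[of "{..n}" "\<lambda>j. (nrm ell2 (U (I (unitv j))))\<^sup>2" "K\<^sup>2"] by (simp add: add.commute)
  with \<epsilon>(2) have "(nrm ell2 (U (I (cut n \<epsilon>))))\<^sup>2 \<le> (real n + 1) * K\<^sup>2" by (rule order_trans)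
  then have le: "L\<^sup>2 * (nrm ell2 (U (I (cut n \<epsilon>))))\<^sup>2 \<le> L\<^sup>2 * ((real n + 1) * K\<^sup>2)"
    by (intro mult_left_mono) auto
  have "(nrm E (I (cut n \<epsilon>)))\<^sup>2 \<le> (L * nrm ell2 (U (I (cut n \<epsilon>))))\<^sup>2"
    using Up(3)[OF Ip[OF cut_ell2(1)]] E.nrm_nonneg[OF Ip[OF cut_ell2(1)]] by (intro power_mono)
  also have "\<dots> \<le> (K * L)\<^sup>2 * (real n + 1)"
    using le by (simp add: power_mult_distrib mult_ac)
  finally have "R * (nrm E (I (cut n \<epsilon>)))\<^sup>2 \<le> R * ((K * L)\<^sup>2 * (real n + 1))"
    using R by (rule mult_left_mono)
  with signed[OF \<epsilon>(1)] have "(real n + 1)\<^sup>2 \<le> R * ((K * L)\<^sup>2 * (real n + 1))" by (rule order_trans)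
  then have "(real n + 1) * (real n + 1) \<le> (real n + 1) * ((K * L)\<^sup>2 * R)"
    by (simp only: power2_eq_square mult_ac)
  then have "real n + 1 \<le> (K * L)\<^sup>2 * R" by (rule mult_left_le_imp_le) auto
  then show ?thesis by (simp add: K_def L_def)
qed

text \<open>
  Dividing \<open>n + 1 \<le> d\<^sup>2(c\<^sup>2n + C)\<close> by \<open>n\<close> and letting \<open>n \<rightarrow> \<infinity>\<close> gives \<open>1 \<le> d\<^sup>2c\<^sup>2\<close>.
\<close>

lemma bm_dist_ge:
  assumes E: "real_nspace E" and F: "real_nspace F" and c: "0 < c"
    and R: "\<And>n. R n \<le> c\<^sup>2 * real n + C"
    and sums: "\<And>U n. isomorphism E F U \<Longrightarrow>
      real n + 1 \<le> (op_norm E F U * op_norm F E (inv_into (pts E) U))\<^sup>2 * R n"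
  shows "ereal (1 / c) \<le> bm_dist E F"
  unfolding bm_dist_def
proof (rule INF_greatest)
  fix U assume "U \<in> {U. isomorphism E F U}"
  then have U: "isomorphism E F U" by simp
  define d where "d = op_norm E F U * op_norm F E (inv_into (pts E) U)"
  have d: "0 \<le> d"
    using U E F unfolding d_def isomorphism_def by (intro mult_nonneg_nonneg op_norm_nonneg) auto
  have "1 \<le> d * c"
  proof (rule ccontr)
    assume "\<not> 1 \<le> d * c"
    then have lt: "(d * c)\<^sup>2 < 1" using d c by (simp add: power_less_one_iff)
    obtain n :: nat where n: "d\<^sup>2 * C < real n * (1 - (d * c)\<^sup>2)"
      using reals_Archimedean3[of "1 - (d * c)\<^sup>2"] lt by auto
    have "real n + 1 \<le> d\<^sup>2 * R n" using sums[OF U] by (simp add: d_def)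
    also have "\<dots> \<le> d\<^sup>2 * (c\<^sup>2 * real n + C)" using R by (intro mult_left_mono) auto
    also have "\<dots> = real n * (d * c)\<^sup>2 + d\<^sup>2 * C" by (simp add: algebra_simps power_mult_distrib)
    finally show False using n by (simp add: algebra_simps)
  qed
  then show "ereal (1 / c) \<le> ereal (op_norm E F U * op_norm F E (inv_into (pts E) U))"
    using c by (simp add: field_simps flip: d_def)
qed


section \<open>Renormings of the sequence space\<close>

locale ell2_renorming = real_nspace E for E :: "'a nspace" +
  fixes I :: "(nat \<Rightarrow> real) \<Rightarrow> 'a" and c :: real
  assumes op: "bounded_op ell2 E I"
    and surj: "I ` pts ell2 = pts E"
    and c: "0 < c"
    and lower: "y \<in> pts ell2 \<Longrightarrow> c * nrm ell2 y \<le> nrm E (I y)"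
    and upper: "y \<in> pts ell2 \<Longrightarrow> nrm E (I y) \<le> nrm ell2 y"
begin

lemma real_nspace_E: "real_nspace E" ..

lemma lower': "y \<in> pts ell2 \<Longrightarrow> nrm ell2 y \<le> (1 / c) * nrm E (I y)"
  using lower[of y] c by (simp add: field_simps)

lemma bm_dist_ell2_le: "bm_dist E ell2 \<le> ereal (1 / c)"
  using bm_dist_le[OF real_nspace_E real_nspace_ell2 op surj, of 1 "1 / c"] upper lower' c by simp

definition functional :: "(nat \<Rightarrow> real) \<Rightarrow> 'a \<Rightarrow> real"
  where "functional y = (\<lambda>x\<in>pts E. inner2 y (inv_into (pts ell2) I x))"

lemma I_closed: "y \<in> pts ell2 \<Longrightarrow> I y \<in> pts E"
  using surj by blast

lemma functional_I: "z \<in> pts ell2 \<Longrightarrow> functional y (I z) = inner2 y z"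
  using inj_on_bounded_below[OF real_nspace_ell2 real_nspace_E op lower']
  by (simp add: functional_def I_closed)

lemma pts_E_cases:
  assumes "x \<in> pts E" obtains z where "z \<in> pts ell2" "x = I z"
  using assms surj by blast

lemma functional_le:
  assumes "y \<in> pts ell2" "x \<in> pts E"
  shows "\<bar>functional y x\<bar> \<le> (1 / c * nrm ell2 y) * nrm E x"
  using assms(2)
proof (cases rule: pts_E_cases)
  case (1 z)
  have "\<bar>functional y x\<bar> \<le> nrm ell2 y * nrm ell2 z"
    using 1 Cauchy_Schwarz_ell2[OF assms(1), of z] by (simp add: functional_I)
  also have "\<dots> \<le> nrm ell2 y * (1 / c * nrm E x)"
    using 1 lower' assms(1) by (intro mult_left_mono) (auto simp: nrm_ell2_nonneg)
  finally show ?thesis by (simp add: mult_ac)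
qed

lemma functional_dual:
  assumes y: "y \<in> pts ell2" shows "functional y \<in> pts (dual E)"
proof -
  have "functional y (add E x x') = functional y x + functional y x'"
    if "x \<in> pts E" "x' \<in> pts E" for x x'
    using that(1)
  proof (cases rule: pts_E_cases)
    case 1: (1 z)
    from that(2) show ?thesis
    proof (cases rule: pts_E_cases)
      case (1 z')
      have "add E x x' = I (\<lambda>j. z j + z' j)"
        using op 1 \<open>z \<in> pts ell2\<close> \<open>x = I z\<close> by (simp add: bounded_op_def ell2_ops)
      then show ?thesis
        using 1 \<open>z \<in> pts ell2\<close> \<open>x = I z\<close> y by (simp add: functional_I add_ell2 inner2_linear)
    qed
  qed
  moreover have "functional y (scl E a x) = a * functional y x" if "x \<in> pts E" for a x
    using that
  proof (cases rule: pts_E_cases)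
    case (1 z)
    have "scl E a x = I (\<lambda>j. a * z j)" using op 1 by (simp add: bounded_op_def ell2_ops)
    then show ?thesis using 1 y by (simp add: functional_I scl_ell2 inner2_linear)
  qed
  moreover have "\<exists>K. \<forall>x\<in>pts E. \<bar>functional y x\<bar> \<le> K * nrm E x"
    using functional_le[OF y] by blast
  moreover have "functional y \<in> extensional (pts E)"
    by (simp add: functional_def)
  ultimately show ?thesis
    by (simp add: in_dual bounded_op_real_line)
qed

lemma functional_norm_le: "y \<in> pts ell2 \<Longrightarrow> nrm (dual E) (functional y) \<le> 1 / c * nrm ell2 y"
  using functional_le c by (intro dual_norm_le real_nspace_E) (auto simp: nrm_ell2_nonneg)

text \<open>
  Test the functional of \<open>y\<close> on \<open>y\<close> itself, whose norm in \<open>E\<close> is at most its Euclidean norm.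
\<close>

lemma functional_norm_ge:
  assumes y: "y \<in> pts ell2" shows "nrm ell2 y \<le> nrm (dual E) (functional y)"
proof (cases "nrm ell2 y = 0")
  case True
  interpret D: real_nspace "dual E" by (rule real_nspace_dual[OF real_nspace_E])
  show ?thesis using True D.nrm_nonneg[OF functional_dual[OF y]] by simp
next
  case False
  interpret D: real_nspace "dual E" by (rule real_nspace_dual[OF real_nspace_E])
  have "nrm ell2 y * nrm ell2 y = \<bar>functional y (I y)\<bar>"
    using y by (simp add: functional_I inner2_self power2_eq_square)
  also have "\<dots> \<le> nrm (dual E) (functional y) * nrm E (I y)"
    using y by (intro dual_bound real_nspace_E functional_dual I_closed)
  also have "\<dots> \<le> nrm (dual E) (functional y) * nrm ell2 y"
    using y by (intro mult_left_mono upper D.nrm_nonneg functional_dual)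
  finally show ?thesis
    using False nrm_ell2_nonneg[OF y] by (simp add: mult_le_cancel_right)
qed

lemma functional_op: "bounded_op ell2 (dual E) functional"
proof -
  have "functional (add ell2 y y') = add (dual E) (functional y) (functional y')"
    if "y \<in> pts ell2" "y' \<in> pts ell2" for y y'
  proof
    fix x
    show "functional (add ell2 y y') x = add (dual E) (functional y) (functional y') x"
    proof (cases "x \<in> pts E")
      case True
      then show ?thesis
        by (cases rule: pts_E_cases)
           (use that in \<open>simp add: functional_I I_closed ell2_ops dual_def inner2_linear\<close>)
    qed (simp add: functional_def dual_def)
  qed
  moreover have "functional (scl ell2 a y) = scl (dual E) a (functional y)"
    if "y \<in> pts ell2" for a y
  proof
    fix x
    show "functional (scl ell2 a y) x = scl (dual E) a (functional y) x"
    proof (cases "x \<in> pts E")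
      case True
      then show ?thesis
        by (cases rule: pts_E_cases)
           (use that in \<open>simp add: functional_I I_closed ell2_ops dual_def inner2_linear\<close>)
    qed (simp add: functional_def dual_def)
  qed
  ultimately show ?thesis
    using functional_dual functional_norm_le unfolding bounded_op_def by blast
qed

text \<open>
  This is the Riesz representation argument: a functional is determined by its values \<open>y\<^sub>j\<close> on the
  unit vectors, and testing it on the truncations of \<open>y\<close> shows that \<open>y\<close> is square-summable.
\<close>

lemma functional_surj:
  assumes f: "f \<in> pts (dual E)"
  obtains y where "y \<in> pts ell2" "functional y = f"
proof -
  interpret D: real_nspace "dual E" by (rule real_nspace_dual[OF real_nspace_E])
  define y where "y j = f (I (unitv j))" for j
  have f_lin: "f (I (add ell2 u v)) = f (I u) + f (I v)" "f (I (scl ell2 a u)) = a * f (I u)"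
    if "u \<in> pts ell2" "v \<in> pts ell2" for u v a
  proof -
    have "I (add ell2 u v) = add E (I u) (I v)" "I (scl ell2 a u) = scl E a (I u)"
      using op that by (simp_all add: bounded_op_def)
    then show "f (I (add ell2 u v)) = f (I u) + f (I v)" "f (I (scl ell2 a u)) = a * f (I u)"
      using f that by (simp_all add: in_dual bounded_op_real_line I_closed)
  qed
  have f_cut: "f (I (cut n z)) = (\<Sum>j\<le>n. y j * z j)" for n z
  proof (induction n)
    case 0
    then show ?case using f_lin(2)[OF unitv_ell2 unitv_ell2] by (simp add: cut_0 y_def)
  next
    case (Suc n)
    have "scl ell2 (z (Suc n)) (unitv (Suc n)) \<in> pts ell2"
      by (intro real_nspace.scl_closed real_nspace_ell2 unitv_ell2)
    then show ?case
      using Suc f_lin(1)[OF cut_ell2(1)] f_lin(2)[OF unitv_ell2 unitv_ell2]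
      by (simp add: cut_Suc y_def)
  qed
  have f_le: "\<bar>f (I z)\<bar> \<le> nrm (dual E) f * nrm ell2 z" if "z \<in> pts ell2" for z
    using dual_bound[OF real_nspace_E f I_closed[OF that]]
      mult_left_mono[OF upper[OF that] D.nrm_nonneg[OF f]] by simp
  have le: "L2_set y {..n} \<le> nrm (dual E) f" for n
  proof (cases "nrm ell2 (cut n y) = 0")
    case True
    then show ?thesis
      using cut_ell2(2)[of n y] D.nrm_nonneg[OF f] by (simp add: L2_set_def)
  next
    case False
    have "nrm ell2 (cut n y) * nrm ell2 (cut n y) = f (I (cut n y))"
      using cut_ell2(2)[of n y] by (simp add: f_cut power2_eq_square)
    also have "\<dots> \<le> nrm (dual E) f * nrm ell2 (cut n y)"
      using f_le[OF cut_ell2(1)[of n y]] by simp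
    finally have "nrm ell2 (cut n y) \<le> nrm (dual E) f"
      using False nrm_ell2_nonneg[OF cut_ell2(1)[of n y]] by (simp add: mult_le_cancel_right)
    moreover have "L2_set y {..n} = nrm ell2 (cut n y)"
      using cut_ell2[of n y] nrm_ell2_nonneg[OF cut_ell2(1)[of n y]]
      by (simp add: L2_set_def real_sqrt_unique)
    ultimately show ?thesis by simp
  qed
  have "L2_set y {..<n} \<le> nrm (dual E) f" for n
    using le[of "n - 1"] D.nrm_nonneg[OF f]
    by (cases n) (auto simp: lessThan_Suc_atMost)
  then have y: "y \<in> pts ell2" by (rule ell2I)
  have "functional y = f"
  proof
    fix x
    show "functional y x = f x"
    proof (cases "x \<in> pts E")
      case False
      then show ?thesis using f by (auto simp: functional_def in_dual extensional_arb[of f "pts E"])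
    next
      case True
      then obtain z where z: "z \<in> pts ell2" "x = I z" by (rule pts_E_cases)
      have "(\<lambda>n. f (I (cut n z)) - f (I z)) \<longlonglongrightarrow> 0"
      proof (rule Lim_null_comparison)
        have d: "diff ell2 (cut n z) z \<in> pts ell2" for n
          by (intro real_nspace.diff_closed real_nspace_ell2 cut_ell2 z)
        have eq: "f (I (cut n z)) = f (I (diff ell2 (cut n z) z)) + f (I z)" for n
        proof -
          have "add ell2 (diff ell2 (cut n z) z) z = cut n z" by (simp add: diff_ell2 ell2_ops(2))
          then show ?thesis using f_lin(1)[OF d z(1), of n] by simp
        qed
        show "\<forall>\<^sub>F n in sequentially. norm (f (I (cut n z)) - f (I z))
            \<le> nrm (dual E) f * nrm ell2 (diff ell2 (cut n z) z)"
          unfolding eq add_diff_cancel_right' real_norm_def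
          by (intro always_eventually allI f_le d)
        show "(\<lambda>n. nrm (dual E) f * nrm ell2 (diff ell2 (cut n z) z)) \<longlonglongrightarrow> 0"
          by (intro tendsto_mult_right_zero cut_tendsto z)
      qed
      then have "(\<lambda>n. f (I (cut n z))) \<longlonglongrightarrow> f (I z)" by (rule LIM_zero_cancel)
      moreover have "(\<lambda>n. f (I (cut n z))) \<longlonglongrightarrow> inner2 y z"
        unfolding f_cut inner2_def by (intro summable_LIMSEQ' summable_inner2 y z)
      ultimately have "f (I z) = inner2 y z" by (rule LIMSEQ_unique)
      then show ?thesis using z by (simp add: functional_I)
    qed
  qed
  with y show ?thesis by (rule that)
qed

lemma bm_dist_dual_le: "bm_dist (dual E) ell2 \<le> ereal (1 / c)"
proof -
  have "functional ` pts ell2 = pts (dual E)"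
    using functional_dual functional_surj by blast
  from bm_dist_le[OF real_nspace_dual[OF real_nspace_E] real_nspace_ell2 functional_op this,
      of "1 / c" 1]
  show ?thesis using functional_norm_le functional_norm_ge c by simp
qed

end


section \<open>The spaces \<open>A(N\<^sub>n)\<close> as renormings of the sequence space\<close>

text \<open>
  The two quadratic estimates for \<open>N\<^sub>n\<close> pass to \<open>M\<^sub>n\<close> by induction and confine the norm of
  \<open>A(N\<^sub>n)\<close> between \<open>c\<close> times the Euclidean norm and the Euclidean norm.
\<close>

locale quadratic_norms =
  fixes N :: "nat \<Rightarrow> real \<Rightarrow> real \<Rightarrow> real" and c :: real
  assumes N: "n \<ge> 1 \<Longrightarrow> absolute_normalized_norm (N n)"
    and c: "0 < c" "c \<le> 1"
    and N_lower: "n \<ge> 1 \<Longrightarrow> s\<^sup>2 + c\<^sup>2 * t\<^sup>2 \<le> (N n s t)\<^sup>2"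
    and N_upper: "n \<ge> 1 \<Longrightarrow> (N n s t)\<^sup>2 \<le> s\<^sup>2 + t\<^sup>2"
begin

interpretation c00: real_nspace "c00 N"
  by (rule real_nspace_c00[OF N])

lemma Mn_ge_0: "0 \<le> Mn N n x"
  by (rule Mn_nonneg[OF N])

lemma nrm_c00_eq: "\<forall>j>n. x j = 0 \<Longrightarrow> nrm (c00 N) x = Mn N n x"
  by (rule nrm_c00[OF N])

lemma Mn_lower: "c\<^sup>2 * (\<Sum>j\<le>n. (x j)\<^sup>2) \<le> (Mn N n x)\<^sup>2"
proof (induction n)
  case 0
  have "c\<^sup>2 * (x 0)\<^sup>2 \<le> 1 * (x 0)\<^sup>2" using c by (intro mult_right_mono) (auto simp: power_le_one)
  then show ?case by simp
next
  case (Suc n)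
  then show ?case
    using N_lower[of "Suc n" "Mn N n x" "\<bar>x (Suc n)\<bar>"] by (simp add: distrib_left)
qed

lemma Mn_upper: "(Mn N n x)\<^sup>2 \<le> (\<Sum>j\<le>n. (x j)\<^sup>2)"
proof (induction n)
  case (Suc n)
  then show ?case
    using N_upper[of "Suc n" "Mn N n x" "\<bar>x (Suc n)\<bar>"] by simp
qed simp

lemma Mn_cong: "(\<And>j. j \<le> n \<Longrightarrow> \<bar>x j\<bar> = \<bar>y j\<bar>) \<Longrightarrow> Mn N n x = Mn N n y"
  by (induction n) auto

lemma coordinate_le_Mn: "j \<le> n \<Longrightarrow> \<bar>x j\<bar> \<le> Mn N n x"
proof (induction n)
  case (Suc n)
  have a: "absolute_normalized_norm (N (Suc n))" using N by simp
  have nn: "0 \<le> Mn N n x" by (rule Mn_ge_0)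
  show ?case
  proof (cases "j = Suc n")
    case True
    define r where "r = \<bar>x (Suc n)\<bar>"
    have "N (Suc n) (r * 0) (r * 1) = \<bar>r\<bar> * N (Suc n) 0 1" "N (Suc n) 0 1 = 1"
      using a unfolding absolute_normalized_norm_def by blast+
    then have "N (Suc n) 0 \<bar>x (Suc n)\<bar> = \<bar>x (Suc n)\<bar>" by (simp add: r_def)
    then show ?thesis
      using absolute_norm_mono[OF a order_refl nn, of "\<bar>x (Suc n)\<bar>"] True by simp
  next
    case False
    then have "\<bar>x j\<bar> \<le> Mn N n x" using Suc by simp
    also have "\<dots> = N (Suc n) (Mn N n x) 0" by (rule N_s0[OF N nn, symmetric]) simp
    also have "\<dots> \<le> Mn N (Suc n) x" using absolute_norm_mono2[OF a, of 0] by simp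
    finally show ?thesis .
  qed
qed simp

lemma c00_ell2:
  assumes "x \<in> pts (c00 N)"
  shows "x \<in> pts ell2" "nrm (c00 N) x \<le> nrm ell2 x" "c * nrm ell2 x \<le> nrm (c00 N) x"
proof -
  obtain n where n: "\<forall>j>n. x j = 0" using c00_bound[OF N assms] by blast
  note x = finite_support_ell2[OF n]
  show "x \<in> pts ell2" by (rule x)
  have M: "nrm (c00 N) x = Mn N n x" "0 \<le> Mn N n x"
    using nrm_c00_eq[OF n] Mn_ge_0 by auto
  show "nrm (c00 N) x \<le> nrm ell2 x"
    unfolding M(1)
    by (rule power2_le_imp_le) (use Mn_upper[of n x] x nrm_ell2_nonneg in auto)
  show "c * nrm ell2 x \<le> nrm (c00 N) x"
    unfolding M(1)
    by (rule power2_le_imp_le) (use Mn_lower[of x n] x M(2) in \<open>auto simp: power_mult_distrib\<close>)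
qed

lemma diff_c00: "diff (c00 N) = diff ell2"
  by (intro ext) (simp add: diff_def c00_def ell2_ops)

lemma cut_c00: "cut n x \<in> pts (c00 N)"
proof -
  have "finite {j. cut n x j \<noteq> 0}"
    by (rule finite_subset[of _ "{..n}"]) (auto simp: cut_def)
  then show ?thesis by (simp add: c00_def)
qed

lemma nrm_cut: "nrm (c00 N) (cut n x) = Mn N n x"
proof -
  have "nrm (c00 N) (cut n x) = Mn N n (cut n x)"
    using nrm_c00_eq[of n "cut n x"] by (simp add: cut_zero)
  also have "\<dots> = Mn N n x" by (rule Mn_cong) (simp add: cut_def)
  finally show ?thesis .
qed

lemma Cauchy_cut:
  assumes y: "y \<in> pts ell2"
  shows "(\<lambda>n. cut n y) \<in> Cauchy_seqs (c00 N)"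
proof -
  interpret l: real_nspace ell2 by (rule real_nspace_ell2)
  have "\<exists>k. \<forall>m\<ge>k. \<forall>n\<ge>k. nrm (c00 N) (diff (c00 N) (cut m y) (cut n y)) < e" if e: "e > 0" for e
  proof -
    have "\<forall>\<^sub>F n in sequentially. nrm ell2 (diff ell2 (cut n y) y) < e / 2"
      using order_tendstoD(2)[OF cut_tendsto[OF y], of "e / 2"] e by simp
    then obtain k where k: "\<And>n. n \<ge> k \<Longrightarrow> nrm ell2 (diff ell2 (cut n y) y) < e / 2"
      by (auto simp: eventually_sequentially)
    have "nrm (c00 N) (diff (c00 N) (cut m y) (cut n y)) < e" if mn: "m \<ge> k" "n \<ge> k" for m n
    proof -
      have "nrm (c00 N) (diff (c00 N) (cut m y) (cut n y)) \<le> nrm ell2 (diff ell2 (cut m y) (cut n y))"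
        using c00_ell2(2)[OF c00.diff_closed[OF cut_c00 cut_c00]] by (simp add: diff_c00)
      also have "\<dots> \<le> nrm ell2 (diff ell2 (cut m y) y) + nrm ell2 (diff ell2 y (cut n y))"
        by (intro l.nrm_diff_triangle cut_ell2 y)
      also have "nrm ell2 (diff ell2 y (cut n y)) = nrm ell2 (diff ell2 (cut n y) y)"
        by (intro l.nrm_diff_commute cut_ell2 y)
      finally show ?thesis using k[OF mn(1)] k[OF mn(2)] by simp
    qed
    then show ?thesis by blast
  qed
  then show ?thesis by (simp add: Cauchy_seqs_def cut_c00)
qed

definition embed :: "(nat \<Rightarrow> real) \<Rightarrow> (nat \<Rightarrow> nat \<Rightarrow> real) set"
  where "embed y = Cauchy_rel (c00 N) `` {\<lambda>n. cut n y}"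

lemma nrm_embed_tendsto:
  assumes "y \<in> pts ell2"
  shows "(\<lambda>n. Mn N n y) \<longlonglongrightarrow> nrm (Aspace N) (embed y)"
  using c00.nrm_completion[OF Cauchy_cut[OF assms]] by (simp add: nrm_cut Aspace_def embed_def)

lemma nrm_embed_finite:
  assumes "\<forall>j>n. x j = 0"
  shows "nrm (Aspace N) (embed x) = Mn N n x"
proof (rule LIMSEQ_unique[OF nrm_embed_tendsto])
  show "x \<in> pts ell2" using assms by (rule finite_support_ell2)
  show "(\<lambda>m. Mn N m x) \<longlonglongrightarrow> Mn N n x"
  proof (rule tendsto_eventually)
    show "\<forall>\<^sub>F m in sequentially. Mn N m x = Mn N n x"
      by (rule eventually_sequentiallyI, rule Mn_stable[OF N assms])
  qed
qed

lemma coordinate_le_nrm_embed: "y \<in> pts ell2 \<Longrightarrow> \<bar>y j\<bar> \<le> nrm (Aspace N) (embed y)"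
  by (rule LIMSEQ_le_const[OF nrm_embed_tendsto]) (auto intro: coordinate_le_Mn)

lemma embed_op: "bounded_op ell2 (Aspace N) embed"
  and embed_upper: "y \<in> pts ell2 \<Longrightarrow> nrm (Aspace N) (embed y) \<le> nrm ell2 y"
proof -
  show upper: "nrm (Aspace N) (embed y) \<le> nrm ell2 y" if y: "y \<in> pts ell2" for y
  proof (rule LIMSEQ_le_const2[OF nrm_embed_tendsto[OF y]])
    have "Mn N n y \<le> nrm ell2 y" for n
    proof (rule power2_le_imp_le)
      show "(Mn N n y)\<^sup>2 \<le> (nrm ell2 y)\<^sup>2"
        using Mn_upper[of n y] sum_le_suminf[of "\<lambda>j. (y j)\<^sup>2" "{..n}"] y
        by (simp add: nrm_ell2_sq) (simp add: ell2_ops)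
    qed (rule nrm_ell2_nonneg[OF y])
    then show "\<exists>k. \<forall>n\<ge>k. Mn N n y \<le> nrm ell2 y" by blast
  qed
  have "embed (add ell2 x y) = add (Aspace N) (embed x) (embed y)"
    if "x \<in> pts ell2" "y \<in> pts ell2" for x y
  proof -
    have "cut n (add ell2 x y) = add (c00 N) (cut n x) (cut n y)" for n
      by (auto simp: cut_def ell2_ops c00_def)
    then show ?thesis
      using c00.add_completion[OF Cauchy_cut Cauchy_cut, OF that]
      by (simp add: embed_def Aspace_def)
  qed
  moreover have "embed (scl ell2 a y) = scl (Aspace N) a (embed y)" if "y \<in> pts ell2" for a y
  proof -
    have "cut n (scl ell2 a y) = scl (c00 N) a (cut n y)" for n
      by (auto simp: cut_def ell2_ops c00_def)
    then show ?thesis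
      using c00.scl_completion[OF Cauchy_cut, OF that] by (simp add: embed_def Aspace_def)
  qed
  moreover have "embed y \<in> pts (Aspace N)" if "y \<in> pts ell2" for y
    unfolding embed_def Aspace_def c00.pts_completion using Cauchy_cut[OF that] by blast
  moreover have "\<exists>K. \<forall>y\<in>pts ell2. nrm (Aspace N) (embed y) \<le> K * nrm ell2 y"
    using upper by (intro exI[of _ 1]) simp
  ultimately show "bounded_op ell2 (Aspace N) embed"
    unfolding bounded_op_def by blast
qed

lemma embed_lower:
  assumes y: "y \<in> pts ell2" shows "c * nrm ell2 y \<le> nrm (Aspace N) (embed y)"
proof (rule LIMSEQ_le[OF _ nrm_embed_tendsto[OF y]])
  show "(\<lambda>n. c * sqrt (\<Sum>j\<le>n. (y j)\<^sup>2)) \<longlonglongrightarrow> c * nrm ell2 y"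
    unfolding nrm_ell2
    by (intro tendsto_intros summable_LIMSEQ') (use y in \<open>simp add: ell2_ops\<close>)
  have "c * sqrt (\<Sum>j\<le>n. (y j)\<^sup>2) \<le> Mn N n y" for n
    by (rule power2_le_imp_le)
       (use Mn_lower[of y n] Mn_ge_0 in \<open>auto simp: power_mult_distrib sum_nonneg\<close>)
  then show "\<exists>k. \<forall>n\<ge>k. c * sqrt (\<Sum>j\<le>n. (y j)\<^sup>2) \<le> Mn N n y" by blast
qed

text \<open>
  A Cauchy sequence of finitely supported vectors is also Cauchy in \<open>\<ell>\<^sub>2\<close>; it is equivalent to the
  sequence of truncations of its limit there.
\<close>

lemma embed_surj: "embed ` pts ell2 = pts (Aspace N)"
proof
  show "embed ` pts ell2 \<subseteq> pts (Aspace N)" using embed_op by (auto simp: bounded_op_def)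
  show "pts (Aspace N) \<subseteq> embed ` pts ell2"
  proof
    interpret l: real_nspace ell2 by (rule real_nspace_ell2)
    fix X assume "X \<in> pts (Aspace N)"
    then obtain x where x: "x \<in> Cauchy_seqs (c00 N)" "X = Cauchy_rel (c00 N) `` {x}"
      unfolding Aspace_def c00.pts_completion by blast
    have xp: "x n \<in> pts (c00 N)" for n by (rule c00.Cauchy_pts[OF x(1)])
    have xl: "x n \<in> pts ell2" for n by (rule c00_ell2[OF xp])
    have "\<exists>k. \<forall>m\<ge>k. \<forall>n\<ge>k. nrm ell2 (diff ell2 (x m) (x n)) < e" if e: "e > 0" for e
    proof -
      have ce: "c * e > 0" using e c by simp
      obtain k where k: "\<And>m n. m \<ge> k \<Longrightarrow> n \<ge> k \<Longrightarrow> nrm (c00 N) (diff (c00 N) (x m) (x n)) < c * e"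
        using c00.Cauchy_E[OF x(1) ce] by blast
      have "nrm ell2 (diff ell2 (x m) (x n)) < e" if "m \<ge> k" "n \<ge> k" for m n
      proof -
        have "c * nrm ell2 (diff ell2 (x m) (x n)) < c * e"
          using c00_ell2(3)[OF c00.diff_closed[OF xp xp], of m n] k[OF that] by (simp add: diff_c00)
        then show ?thesis using c by simp
      qed
      then show ?thesis by blast
    qed
    then have "x \<in> Cauchy_seqs ell2" using xl by (simp add: Cauchy_seqs_def)
    then obtain y where y: "y \<in> pts ell2" "(\<lambda>n. nrm ell2 (diff ell2 (x n) y)) \<longlonglongrightarrow> 0"
      by (rule complete_ell2)
    have "(\<lambda>n. nrm ell2 (diff ell2 (x n) y) + nrm ell2 (diff ell2 (cut n y) y)) \<longlonglongrightarrow> 0"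
      by (intro tendsto_add_zero y cut_tendsto)
    then have "(\<lambda>n. nrm (c00 N) (diff (c00 N) (x n) (cut n y))) \<longlonglongrightarrow> 0"
    proof (rule LIMSEQ_squeeze_0)
      fix n
      show "0 \<le> nrm (c00 N) (diff (c00 N) (x n) (cut n y))"
        by (intro c00.nrm_nonneg c00.diff_closed xp cut_c00)
      have "nrm (c00 N) (diff (c00 N) (x n) (cut n y)) \<le> nrm ell2 (diff ell2 (x n) (cut n y))"
        using c00_ell2(2)[OF c00.diff_closed[OF xp cut_c00]] by (simp add: diff_c00)
      also have "\<dots> \<le> nrm ell2 (diff ell2 (x n) y) + nrm ell2 (diff ell2 y (cut n y))"
        by (intro l.nrm_diff_triangle xl cut_ell2 y)
      also have "nrm ell2 (diff ell2 y (cut n y)) = nrm ell2 (diff ell2 (cut n y) y)"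
        by (intro l.nrm_diff_commute cut_ell2 y)
      finally show "nrm (c00 N) (diff (c00 N) (x n) (cut n y))
        \<le> nrm ell2 (diff ell2 (x n) y) + nrm ell2 (diff ell2 (cut n y) y)" .
    qed
    then have "X = embed y"
      using x c00.cls_eq[OF x(1) Cauchy_cut[OF y(1)]] by (simp add: embed_def)
    then show "X \<in> embed ` pts ell2" using y by blast
  qed
qed

sublocale ell2_renorming "Aspace N" embed c
proof -
  interpret banach_nspace "Aspace N" by (rule banach_nspace_Aspace[OF N])
  show "ell2_renorming (Aspace N) embed c"
    by unfold_locales (auto simp: embed_op embed_surj c embed_lower embed_upper)
qed

lemma nrm_embed_signs:
  assumes "\<forall>j. \<bar>\<epsilon> j\<bar> = 1"
  shows "nrm (Aspace N) (embed (cut n \<epsilon>)) = Mn N n (\<lambda>_. 1)"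
proof -
  have "nrm (Aspace N) (embed (cut n \<epsilon>)) = Mn N n (cut n \<epsilon>)"
    by (rule nrm_embed_finite) (simp add: cut_zero)
  also have "\<dots> = Mn N n (\<lambda>_. 1)" using assms by (intro Mn_cong) (simp add: cut_def)
  finally show ?thesis .
qed

lemma bm_dist_ge_of_growth:
  assumes growth: "\<And>n. (Mn N n (\<lambda>_. 1))\<^sup>2 \<le> c\<^sup>2 * real n + K"
  shows "ereal (1 / c) \<le> bm_dist (Aspace N) ell2"
proof (rule bm_dist_ge[OF real_nspace_E real_nspace_ell2 c(1) growth])
  fix U n assume U: "isomorphism (Aspace N) ell2 U"
  show "real n + 1 \<le> (op_norm (Aspace N) ell2 U *
    op_norm ell2 (Aspace N) (inv_into (pts (Aspace N)) U))\<^sup>2 * (Mn N n (\<lambda>_. 1))\<^sup>2"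
  proof (rule isomorphism_sum_le[OF real_nspace_E embed_op U])
    show "1 \<le> nrm (Aspace N) (embed (unitv j))" for j
      using coordinate_le_nrm_embed[OF unitv_ell2, of j j] by (simp add: unitv_def)
  qed (simp add: nrm_embed_signs)
qed

text \<open>
  The functionals attached to the unit vectors are the coordinate functionals. A signed sum of the
  first \<open>n + 1\<close> of them takes the value \<open>n + 1\<close> at the vector with the same signs, whose norm is
  that of \<open>e\<^sub>0 + \<dots> + e\<^sub>n\<close>.
\<close>

lemma bm_dist_dual_ge_of_growth:
  assumes growth: "\<And>n. (Mn N n (\<lambda>_. 1))\<^sup>2 \<le> c\<^sup>2 * real n + K"
  shows "ereal (1 / c) \<le> bm_dist (dual (Aspace N)) ell2"
proof (rule bm_dist_ge[OF real_nspace_dual[OF real_nspace_E] real_nspace_ell2 c(1) growth])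
  let ?X = "dual (Aspace N)"
  interpret D: real_nspace ?X by (rule real_nspace_dual[OF real_nspace_E])
  fix U n assume U: "isomorphism ?X ell2 U"
  show "real n + 1 \<le> (op_norm ?X ell2 U * op_norm ell2 ?X (inv_into (pts ?X) U))\<^sup>2
    * (Mn N n (\<lambda>_. 1))\<^sup>2"
  proof (rule isomorphism_sum_ge[OF D.real_nspace_axioms functional_op U])
    show "nrm ?X (functional (unitv j)) \<le> 1" for j
    proof (rule dual_norm_le[OF real_nspace_E])
      fix x assume "x \<in> pts (Aspace N)"
      then show "\<bar>functional (unitv j) x\<bar> \<le> 1 * nrm (Aspace N) x"
        by (cases rule: pts_E_cases)
           (simp add: functional_I inner2_unitv coordinate_le_nrm_embed)
    qed simp
    fix \<epsilon> :: "nat \<Rightarrow> real" assume \<epsilon>: "\<forall>j. \<bar>\<epsilon> j\<bar> = 1"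
    then have sq: "(\<epsilon> j)\<^sup>2 = 1" for j by (metis one_power2 power2_abs)
    have "real n + 1 = \<bar>functional (cut n \<epsilon>) (embed (cut n \<epsilon>))\<bar>"
      using cut_ell2[of n \<epsilon>] by (simp add: functional_I inner2_self sq)
    also have "\<dots> \<le> nrm ?X (functional (cut n \<epsilon>)) * nrm (Aspace N) (embed (cut n \<epsilon>))"
      by (intro dual_bound real_nspace_E functional_dual I_closed cut_ell2)
    finally have "real n + 1 \<le> Mn N n (\<lambda>_. 1) * nrm ?X (functional (cut n \<epsilon>))"
      by (simp add: nrm_embed_signs[OF \<epsilon>] mult.commute)
    then have "(real n + 1)\<^sup>2 \<le> (Mn N n (\<lambda>_. 1) * nrm ?X (functional (cut n \<epsilon>)))\<^sup>2"
      by (intro power_mono) auto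
    then show "(real n + 1)\<^sup>2 \<le> (Mn N n (\<lambda>_. 1))\<^sup>2 * (nrm ?X (functional (cut n \<epsilon>)))\<^sup>2"
      by (simp add: power_mult_distrib)
  qed simp
qed

end

section \<open>The norms defining \<open>X\<^sub>c\<close>\<close>

lemma Nc_power:
  assumes "0 < c" "c < 1" "n \<ge> 1"
  shows "((Nc c n s t)\<^sup>2) ^ n = (1 - c ^ (2 * n)) * (t\<^sup>2) ^ n + (s\<^sup>2 + c\<^sup>2 * t\<^sup>2) ^ n"
proof -
  have "0 \<le> (1 - c ^ (2 * n)) * \<bar>t\<bar> ^ (2 * n) + (s\<^sup>2 + c\<^sup>2 * t\<^sup>2) ^ n"
    using assms by (simp add: power_le_one)
  then have "Nc c n s t ^ (2 * n) = (1 - c ^ (2 * n)) * \<bar>t\<bar> ^ (2 * n) + (s\<^sup>2 + c\<^sup>2 * t\<^sup>2) ^ n"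
    using assms by (simp add: Nc_def)
  then show ?thesis by (simp add: power_mult)
qed

lemma Nc_lower:
  assumes "0 < c" "c < 1" "n \<ge> 1"
  shows "s\<^sup>2 + c\<^sup>2 * t\<^sup>2 \<le> (Nc c n s t)\<^sup>2"
proof -
  have "(s\<^sup>2 + c\<^sup>2 * t\<^sup>2) ^ n \<le> ((Nc c n s t)\<^sup>2) ^ n"
    unfolding Nc_power[OF assms] using assms by (simp add: power_le_one)
  then show ?thesis
    using assms(3) power_mono_iff[of "s\<^sup>2 + c\<^sup>2 * t\<^sup>2" "(Nc c n s t)\<^sup>2" n] by simp
qed

text \<open>
  The loss \<open>(a + b)\<^sup>m - (a + qb)\<^sup>m\<close> grows with \<open>a\<close>, hence is at least its value \<open>(1 - q\<^sup>m)b\<^sup>m\<close> at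
  \<open>a = 0\<close>. With \<open>q = c\<^sup>2\<close> this is the upper estimate for \<open>Nc\<close>.
\<close>

lemma power_sum_contraction:
  fixes a b q :: real
  assumes "0 \<le> a" "0 \<le> b" "0 \<le> q" "q \<le> 1"
  shows "(1 - q ^ Suc n) * b ^ Suc n + (a + q * b) ^ Suc n \<le> (a + b) ^ Suc n"
proof (induction n)
  case 0
  show ?case by (simp add: algebra_simps)
next
  case (Suc n)
  define m where "m = Suc n"
  have IH: "(1 - q ^ m) * b ^ m + (a + q * b) ^ m \<le> (a + b) ^ m" using Suc by (simp add: m_def)
  have q1: "0 \<le> 1 - q ^ m" using assms by (simp add: power_le_one)
  have "(q * b) ^ m \<le> (a + q * b) ^ m" using assms by (intro power_mono) auto
  then have p: "(1 - q) * b * (q * b) ^ m \<le> (1 - q) * b * (a + q * b) ^ m"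
    using assms by (intro mult_left_mono) auto
  have "(1 - q ^ Suc m) * b ^ Suc m + (a + q * b) ^ Suc m
      = b * ((1 - q ^ m) * b ^ m) + (1 - q) * b * (q * b) ^ m + (a + q * b) * (a + q * b) ^ m"
    by (simp add: algebra_simps power_mult_distrib)
  also have "\<dots> \<le> b * ((1 - q ^ m) * b ^ m) + a * ((1 - q ^ m) * b ^ m)
      + (1 - q) * b * (a + q * b) ^ m + (a + q * b) * (a + q * b) ^ m"
    using p mult_nonneg_nonneg[OF assms(1) mult_nonneg_nonneg[OF q1 zero_le_power[OF assms(2)]], of m]
    by linarith
  also have "\<dots> = (a + b) * ((1 - q ^ m) * b ^ m + (a + q * b) ^ m)"
    by (simp add: algebra_simps)
  also have "\<dots> \<le> (a + b) * (a + b) ^ m" using IH assms by (intro mult_left_mono) auto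
  finally show ?case by (simp add: m_def)
qed

lemma Nc_upper:
  assumes "0 < c" "c < 1" "n \<ge> 1"
  shows "(Nc c n s t)\<^sup>2 \<le> s\<^sup>2 + t\<^sup>2"
proof -
  have "((Nc c n s t)\<^sup>2) ^ n \<le> (s\<^sup>2 + t\<^sup>2) ^ n"
    unfolding Nc_power[OF assms]
    using power_sum_contraction[of "s\<^sup>2" "t\<^sup>2" "c\<^sup>2" "n - 1"] assms
    by (simp add: power_mult power_le_one)
  then show ?thesis
    using assms(3) power_mono_iff[of "(Nc c n s t)\<^sup>2" "s\<^sup>2 + t\<^sup>2" n] by simp
qed

text \<open>
  With \<open>A = s\<^sup>2 + c\<^sup>2 > 1\<close> the power \<open>Nc\<^sup>2\<^sup>n\<^sup>+\<^sup>2\<close> exceeds \<open>A\<^sup>n\<^sup>+\<^sup>1\<close> by at most one, and already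
  \<open>(A + A\<^sup>-\<^sup>n)\<^sup>n\<^sup>+\<^sup>1\<close> exceeds it by at least one.
\<close>

lemma Nc_step:
  assumes c: "0 < c" "c < 1" and s: "1 \<le> s\<^sup>2"
  shows "(Nc c (Suc n) s 1)\<^sup>2 \<le> s\<^sup>2 + c\<^sup>2 + (1 / (1 + c\<^sup>2)) ^ n"
proof -
  define A where "A = s\<^sup>2 + c\<^sup>2"
  have A: "1 + c\<^sup>2 \<le> A" "0 < A" using s c by (auto simp: A_def intro: add_nonneg_pos)
  define h where "h = (1 / A) ^ n"
  have h: "0 \<le> h" "A ^ n * h = 1" using A by (auto simp: h_def power_divide)
  have "((Nc c (Suc n) s 1)\<^sup>2) ^ Suc n \<le> 1 + A ^ Suc n"
    using Nc_power[OF c, of "Suc n" s 1] c by (simp add: A_def)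
  also have "\<dots> = (A + h) * A ^ n" using h by (simp add: algebra_simps)
  also have "\<dots> \<le> (A + h) * (A + h) ^ n"
    using A h by (intro mult_left_mono power_mono) auto
  finally have "((Nc c (Suc n) s 1)\<^sup>2) ^ Suc n \<le> (A + h) ^ Suc n" by simp
  then have "(Nc c (Suc n) s 1)\<^sup>2 \<le> A + h"
    using A h power_mono_iff[of "(Nc c (Suc n) s 1)\<^sup>2" "A + h" "Suc n"] by simp
  moreover have "h \<le> (1 / (1 + c\<^sup>2)) ^ n"
    unfolding h_def using A by (intro power_mono frac_le) (auto intro: add_pos_nonneg)
  ultimately show ?thesis by (simp add: A_def)
qed

lemma quadratic_norms_Nc: "0 < c \<Longrightarrow> c < 1 \<Longrightarrow> quadratic_norms (Nc c) c"
  by unfold_locales (auto intro: absolute_normalized_norm_Nc Nc_lower Nc_upper)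

lemma Nc_growth:
  assumes "0 < c" "c < 1"
  shows "\<exists>C. \<forall>n. (Mn (Nc c) n (\<lambda>_. 1))\<^sup>2 \<le> c\<^sup>2 * real n + C"
proof -
  interpret quadratic_norms "Nc c" c by (rule quadratic_norms_Nc[OF assms])
  define q where "q = 1 / (1 + c\<^sup>2)"
  have q: "0 \<le> q" "q < 1" using assms by (auto simp: q_def divide_simps add_pos_pos)
  define r where "r n = (Mn (Nc c) n (\<lambda>_. 1))\<^sup>2" for n
  have r1: "1 \<le> r n" for n
    using coordinate_le_Mn[of 0 n "\<lambda>_. 1"] by (simp add: r_def)
  have sum: "r n \<le> 1 + c\<^sup>2 * real n + (\<Sum>k<n. q ^ k)" for n
  proof (induction n)
    case 0
    show ?case by (simp add: r_def)
  next
    case (Suc n)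
    have "r (Suc n) \<le> r n + c\<^sup>2 + q ^ n"
      using Nc_step[OF assms, of "Mn (Nc c) n (\<lambda>_. 1)" n] r1[of n] by (simp add: r_def q_def)
    with Suc show ?case by (simp add: algebra_simps)
  qed
  have geometric: "(\<Sum>k<n. q ^ k) \<le> (\<Sum>k. q ^ k)" for n
    using q by (intro sum_le_suminf summable_geometric) auto
  have "r n \<le> c\<^sup>2 * real n + (1 + (\<Sum>k. q ^ k))" for n
    using sum[of n] geometric[of n] by simp
  then show ?thesis unfolding r_def by blast
qed

theorem mainTheorem6:
  fixes c :: real
  assumes "0 < c" and "c < 1"
  shows "bm_dist (Xspace c) ell2 = ereal (1 / c) \<and> bm_dist (dual (Xspace c)) ell2 = ereal (1 / c)"
proof -
  interpret quadratic_norms "Nc c" c by (rule quadratic_norms_Nc[OF assms])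
  obtain C where "\<And>n. (Mn (Nc c) n (\<lambda>_. 1))\<^sup>2 \<le> c\<^sup>2 * real n + C"
    using Nc_growth[OF assms] by blast
  note ge = bm_dist_ge_of_growth[OF this] bm_dist_dual_ge_of_growth[OF this]
  show ?thesis
    unfolding Xspace_def by (intro conjI antisym bm_dist_ell2_le bm_dist_dual_le ge)
qed

end
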